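(* Let $\mathfrak c=2^{\omega}$, let $D$ be a discrete space of cardinality $\mathfrak c$, let $$D_{\omega}=\bigcup\{\overline{M}^{\,\beta D}: M\subset D,\ |M|\le\omega\}\subset\beta D,$$ and let $K=P(\beta D)$ be the space of Radon probability measures on $\beta D$ with the weak topology, where $\beta D$ is identified with the set of Dirac measures in $K$. Then $K$ is a convex compactum, $D_{\omega}$ is a boundary of $K$, and $w(K)=2^{\mathfrak c}>\mathfrak c=w(D_{\omega})$. In particular, there exist a convex compactum $K$ and a boundary $B$ of $K$ with $w(B)<w(K)$. Moreover, $nw_{cz}(D_{\omega})=2^{\mathfrak c}>\mathfrak c=nw(D_{\omega})=w(D_{\omega})$.
   Context: $\beta D$ is the Stone–Čech compactification and $\overline{M}^{\,\beta D}$ is the closure in $\beta D$. The weak topology on $P(\beta D)$ is generated by the functions $\mu\mapsto\int f\,d\mu$, $f\in C(\beta D)$. A convex compactum is a compact convex subset of a (Hausdorff, real) locally convex linear space. $\mathcal A(K)$ denotes the set of continuous affine functions $f\colon K\to\mathbb R$. A set $B\subset K$ is a boundary of $K$ if for every $f\in\mathcal A(K)$ there is $b\in B$ with $f(b)=\max_{x\in K}f(x)$. $w(X)$ is the weight: the minimal cardinality of a base of $X$, plus $\omega$. A network of $X$ is a family $\mathcal N$ of subsets of $X$ such that each open set is the union of a subfamily of $\mathcal N$; $nw(X)$ is the minimal cardinality of a network, plus $\omega$. A cozero set of $X$ is a set $X\setminus f^{-1}(0)$ with $f\colon X\to\mathbb R$ continuous. A family $\mathcal N$ of subsets of $X$ is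 a $cz$-network if every cozero set of $X$ is the union of an at most countable subfamily of $\mathcal N$; $nw_{cz}(X)$ is the minimal cardinality of a $cz$-network of $X$, plus $\omega$. *)

theory Defs
  imports "HOL-Probability.Probability" "HOL-Library.Function_Algebras"
begin

unbundle cardinal_syntax


section \<open>Real functions as a vector space\<close>

instantiation "fun" :: (type, real_vector) real_vector
begin

definition scaleR_fun_def: "scaleR c f = (\<lambda>x. scaleR c (f x))"

instance
  by standard
    (simp_all add: scaleR_fun_def plus_fun_def scaleR_add_right scaleR_add_left)

end


section \<open>Cardinal invariants\<close>

definition continuum :: "(nat \<Rightarrow> bool) rel" where
  "continuum = ctwo ^c natLeq"

text \<open>The minimal cardinality of a set satisfying \<open>P\<close>; it exists as soon as some set
  satisfies \<open>P\<close>, because cardinals are well-ordered.\<close>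

definition min_card :: "('a set \<Rightarrow> bool) \<Rightarrow> 'a rel" where
  "min_card P = |SOME A. P A \<and> (\<forall>A'. P A' \<longrightarrow> |A| \<le>o |A'| )|"

definition base_of :: "'a topology \<Rightarrow> 'a set set \<Rightarrow> bool" where
  "base_of X \<B> \<longleftrightarrow>
     (\<forall>U\<in>\<B>. openin X U) \<and> (\<forall>U. openin X U \<longrightarrow> (\<exists>\<B>'\<subseteq>\<B>. \<Union>\<B>' = U))"

definition network_of :: "'a topology \<Rightarrow> 'a set set \<Rightarrow> bool" where
  "network_of X \<N> \<longleftrightarrow>
     (\<forall>N\<in>\<N>. N \<subseteq> topspace X) \<and> (\<forall>U. openin X U \<longrightarrow> (\<exists>\<N>'\<subseteq>\<N>. \<Union>\<N>' = U))"

definition cozero_in :: "'a topology \<Rightarrow> 'a set \<Rightarrow> bool" where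
  "cozero_in X U \<longleftrightarrow>
     (\<exists>f. continuous_map X euclideanreal f \<and> U = topspace X - {x \<in> topspace X. f x = 0})"

definition cz_network_of :: "'a topology \<Rightarrow> 'a set set \<Rightarrow> bool" where
  "cz_network_of X \<N> \<longleftrightarrow>
     (\<forall>N\<in>\<N>. N \<subseteq> topspace X) \<and>
     (\<forall>U. cozero_in X U \<longrightarrow> (\<exists>\<N>'\<subseteq>\<N>. countable \<N>' \<and> \<Union>\<N>' = U))"

definition weight :: "'a topology \<Rightarrow> ('a set + nat) rel" where
  "weight X = min_card (base_of X) +c natLeq"

definition network_weight :: "'a topology \<Rightarrow> ('a set + nat) rel" where
  "network_weight X = min_card (network_of X) +c natLeq"

definition cz_network_weight :: "'a topology \<Rightarrow> ('a set + nat) rel" where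
  "cz_network_weight X = min_card (cz_network_of X) +c natLeq"


section \<open>Convex compacta and boundaries\<close>

text \<open>The underlying linear space is \<open>topspace T\<close>, a linear subspace of the ambient type.\<close>

definition locally_convex_space :: "'v::real_vector topology \<Rightarrow> bool" where
  "locally_convex_space T \<longleftrightarrow>
     subspace (topspace T) \<and> Hausdorff_space T \<and>
     continuous_map (prod_topology T T) T (\<lambda>(x, y). x + y) \<and>
     continuous_map (prod_topology euclideanreal T) T (\<lambda>(c, x). c *\<^sub>R x) \<and>
     (\<forall>U. openin T U \<and> 0 \<in> U \<longrightarrow> (\<exists>V. openin T V \<and> convex V \<and> 0 \<in> V \<and> V \<subseteq> U))"

text \<open>A convex compactum is given by its own topology \<open>K\<close>: its linear structure comes from the
  type, and its topology has to be inherited from some locally convex space.\<close>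

definition convex_compactum :: "'v::real_vector topology \<Rightarrow> bool" where
  "convex_compactum K \<longleftrightarrow>
     (\<exists>T S. locally_convex_space T \<and> compactin T S \<and> convex S \<and> K = subtopology T S)"

definition affine_functions :: "'v::real_vector topology \<Rightarrow> ('v \<Rightarrow> real) set" where
  "affine_functions K =
     {f. continuous_map K euclideanreal f \<and>
         (\<forall>x\<in>topspace K. \<forall>y\<in>topspace K. \<forall>t\<in>{0..1}.
            f ((1 - t) *\<^sub>R x + t *\<^sub>R y) = (1 - t) * f x + t * f y)}"

definition boundary_of_compactum :: "'v::real_vector topology \<Rightarrow> 'v set \<Rightarrow> bool" where
  "boundary_of_compactum K B \<longleftrightarrow>
     B \<subseteq> topspace K \<and>
     (\<forall>f\<in>affine_functions K. \<exists>b\<in>B. \<forall>x\<in>topspace K. f x \<le> f b)"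


section \<open>The Stone--Cech compactification\<close>

text \<open>The closure of the canonical image of \<open>X\<close> in the Tychonoff cube with one coordinate for
  each continuous function from \<open>X\<close> to \<open>[0,1]\<close>.  Functions are cut off outside
  \<open>topspace X\<close>, so that each one occurs exactly once.\<close>

type_synonym 'a beta = "('a \<Rightarrow> real) \<Rightarrow> real"

definition unit_functions :: "'a topology \<Rightarrow> ('a \<Rightarrow> real) set" where
  "unit_functions X =
     {f \<in> extensional (topspace X). continuous_map X (top_of_set {0..1}) f}"

definition beta_embed :: "'a topology \<Rightarrow> 'a \<Rightarrow> 'a beta" where
  "beta_embed X x = (\<lambda>f\<in>unit_functions X. f x)"

definition stone_cech :: "'a topology \<Rightarrow> 'a beta topology" where
  "stone_cech X =
     (let cube = product_topology (\<lambda>_. top_of_set {0..1}) (unit_functions X)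
      in subtopology cube (cube closure_of (beta_embed X ` topspace X)))"

definition D_omega :: "'a set \<Rightarrow> 'a beta set" where
  "D_omega D =
     (let X = discrete_topology D
      in \<Union>{stone_cech X closure_of (beta_embed X ` M) | M. M \<subseteq> D \<and> countable M})"


section \<open>Radon probability measures\<close>

definition borel_measure :: "'b topology \<Rightarrow> 'b measure" where
  "borel_measure X = sigma (topspace X) {U. openin X U}"

definition radon_prob :: "'b topology \<Rightarrow> 'b measure set" where
  "radon_prob X =
     {M. prob_space M \<and> space M = topspace X \<and> sets M = sets (borel_measure X) \<and>
         (\<forall>A\<in>sets M. emeasure M A = (SUP C\<in>{C. compactin X C \<and> C \<subseteq> A}. emeasure M C))}"

text \<open>The type \<open>'b measure\<close> carries no linear structure, so a measure is represented here by its
  real-valued set function \<open>measure M\<close>, which is \<open>0\<close> outside \<open>sets M\<close> and determines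
  \<open>M\<close> in \<open>radon_prob X\<close>.  Set functions are added and scaled pointwise.  The topology is the
  weak one, generated by the maps sending \<open>M\<close> to the integral of \<open>f\<close> for continuous \<open>f\<close>.\<close>

type_synonym 'b set_function = "'b set \<Rightarrow> real"

definition prob_measures :: "'b topology \<Rightarrow> 'b set_function topology" where
  "prob_measures X =
     topology_generated_by
       {{measure M | M. M \<in> radon_prob X \<and> (LINT x|M. f x) \<in> U} | f U.
          continuous_map X euclideanreal f \<and> open (U :: real set)}"

definition dirac :: "'b topology \<Rightarrow> 'b \<Rightarrow> 'b set_function" where
  "dirac X x = measure (return (borel_measure X) x)"

end

theory Submission
  imports Defs
begin

text \<open>For discrete \<open>D\<close> the clopen subsets of \<open>\<beta>D\<close> are the closures \<open>clp A\<close> of the subsets \<open>A\<close> of \<open>D\<close>,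
  and a Radon probability measure on \<open>\<beta>D\<close> is the same thing as a finitely additive probability on all
  subsets of \<open>D\<close>, its weak topology being that of pointwise convergence.  So \<open>K\<close> is a closed subset
  of a cube with one factor per subset of \<open>D\<close>: it is compact, its weight is at most the number of
  subsets of \<open>D\<close>, and the convex combinations of Dirac measures at points of \<open>D\<close> are dense in it.
  Hence an affine continuous function is bounded by its supremum over \<open>D\<close>, which is attained at
  a cluster point of a maximising sequence, and such a point lies in \<open>D\<^sub>\<omega>\<close>.

  The sets \<open>clp A\<close> with \<open>A\<close> countable form a base of \<open>D\<^sub>\<omega>\<close>, and there are only continuum many of them.
  Conversely, \<open>D\<^sub>\<omega>\<close> contains a cluster point of each sequence in \<open>D\<close>; therefore the closures of the
  members of a cz-network of \<open>D\<^sub>\<omega>\<close> form a network of \<open>\<beta>D\<close>, and by compactness a network of \<open>\<beta>D\<close> is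
  at least as large as the family of clopen sets.\<close>

section \<open>Stone--Cech compactifications of discrete spaces\<close>

text \<open>Two counts drive all cardinalities. Since \<open>continuum ^c natLeq\<close> equals
  \<open>continuum\<close>, the set \<open>D\<close> has only \<open>continuum\<close> many
  countable subsets, while it has \<open>ctwo ^c continuum\<close> many subsets in all; the first
  count governs the base of \<open>D_omega\<close>, the second governs \<beta>D, \<open>K\<close>
  and the cz-networks. Finite additivity is enough for measures because a countable open cover of a
  clopen set has a finite subcover: the values on clopen sets pass through the Caratheodory
  construction without loss. An ordinary network may use uncountably many members for one open set.
  A cz-network may use only countably many, and exactly this makes a diagonal sequence against the
  cover of one cozero set possible; so cz-networks of the small space \<open>D_omega\<close> still
  detect the clopen sets of \<beta>D. Making \<open>K\<close> a convex compactum meets an obstacle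
  in the representation by set functions: evaluations at clopen sets do not separate arbitrary set
  functions. The locally convex space around \<open>K\<close> is therefore only the linear span of
  the Radon probability measures, where they do separate.\<close>

text \<open>The locale assumptions characterise the Stone--Cech compactification \<open>X\<close> of the discrete space
  \<open>D\<close>, embedded by \<open>e\<close>.  The sets \<open>clp A\<close> are exactly its clopen sets.\<close>

locale discrete_beta =
  fixes X :: "'b topology" and D :: "'a set" and e :: "'a \<Rightarrow> 'b"
  assumes compact: "compact_space X"
    and Hausdorff: "Hausdorff_space X"
    and dense: "X closure_of (e ` D) = topspace X"
    and embed: "e ` D \<subseteq> topspace X"
    and closure_open: "A \<subseteq> D \<Longrightarrow> openin X (X closure_of (e ` A))"
    and closure_disjoint: "A \<subseteq> D \<Longrightarrow> X closure_of (e ` A) \<inter> X closure_of (e ` (D - A)) = {}"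
begin

definition clp :: "'a set \<Rightarrow> 'b set" where
  "clp A = X closure_of (e ` A)"

lemma clp_open: "A \<subseteq> D \<Longrightarrow> openin X (clp A)"
  and clp_closed: "closedin X (clp A)"
  and clp_subset: "clp A \<subseteq> topspace X"
  and clp_D: "clp D = topspace X"
  and clp_empty [simp]: "clp {} = {}"
  and clp_Un: "clp (A \<union> B) = clp A \<union> clp B"
  by (simp_all add: clp_def closure_open closure_of_subset_topspace dense image_Un closure_of_Un)

lemma clp_mono: "A \<subseteq> B \<Longrightarrow> clp A \<subseteq> clp B"
  by (simp add: clp_def closure_of_mono image_mono)

lemma clp_compl:
  assumes "A \<subseteq> D" shows "clp (D - A) = topspace X - clp A"
proof -
  have "clp A \<union> clp (D - A) = topspace X"
    using assms by (metis Un_Diff_cancel clp_D clp_Un sup.absorb2)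
  then show ?thesis
    using closure_disjoint[OF assms] clp_subset unfolding clp_def by blast
qed

lemma clp_disjoint: "A \<subseteq> D \<Longrightarrow> B \<subseteq> D \<Longrightarrow> A \<inter> B = {} \<Longrightarrow> clp A \<inter> clp B = {}"
  using clp_compl[of A] clp_mono[of B "D - A"] by blast

lemma clp_Int:
  assumes "A \<subseteq> D" "B \<subseteq> D" shows "clp (A \<inter> B) = clp A \<inter> clp B"
proof
  show "clp (A \<inter> B) \<subseteq> clp A \<inter> clp B" by (simp add: clp_mono)
  have "clp A = clp (A \<inter> B) \<union> clp (A - B)"
    by (metis Int_Diff_Un clp_Un)
  moreover have "clp (A - B) \<inter> clp B = {}"
    using assms by (intro clp_disjoint) auto
  ultimately show "clp A \<inter> clp B \<subseteq> clp (A \<inter> B)" by blast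
qed

lemma clp_UN_finite: "finite I \<Longrightarrow> clp (\<Union>i\<in>I. A i) = (\<Union>i\<in>I. clp (A i))"
  by (induction I rule: finite_induct) (simp_all add: clp_Un)

lemma clp_point: "d \<in> A \<Longrightarrow> A \<subseteq> D \<Longrightarrow> e d \<in> clp A"
  using embed unfolding clp_def by (meson closure_of_subset image_eqI image_mono subset_iff subset_trans)

lemma clp_point_iff: "d \<in> D \<Longrightarrow> A \<subseteq> D \<Longrightarrow> e d \<in> clp A \<longleftrightarrow> d \<in> A"
  using clp_point[of d A] clp_point[of d "D - A"] clp_compl[of A] by blast

lemma clp_subset_iff:
  assumes "A \<subseteq> D" "B \<subseteq> D"
  shows "clp A \<subseteq> clp B \<longleftrightarrow> A \<subseteq> B"
proof
  assume sub: "clp A \<subseteq> clp B"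
  show "A \<subseteq> B"
  proof
    fix d assume "d \<in> A"
    then show "d \<in> B"
      using sub assms clp_point[of d A] clp_point_iff[of d B] by blast
  qed
qed (rule clp_mono)

lemma inj_embed: "inj_on e D"
proof (rule inj_onI)
  fix c d assume *: "c \<in> D" "d \<in> D" "e c = e d"
  then have "e d \<in> clp {c}" using clp_point[of c "{c}"] by simp
  then have "d \<in> {c}" using * clp_point_iff[of d "{c}"] by simp
  then show "c = d" by simp
qed

lemma clp_nonempty: "A \<noteq> {} \<Longrightarrow> A \<subseteq> D \<Longrightarrow> clp A \<noteq> {}"
  using clp_point by blast

lemma clp_finite:
  assumes "finite A" "A \<subseteq> D"
  shows "clp A = e ` A"
proof -
  have "closedin X (e ` A)"
    using assms embed Hausdorff
    by (intro closedin_Hausdorff_finite) auto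
  then show ?thesis by (simp add: clp_def closure_of_closedin)
qed

lemma compactin_clp: "compactin X (clp A)"
  using closedin_compact_space[OF compact clp_closed] .

text \<open>A compact Hausdorff space is regular, so \<open>p\<close> has an open neighbourhood
  \<open>V\<close> inside a closed \<open>C\<close> inside \<open>U\<close>. By density of the image
  of \<open>D\<close>, the point \<open>p\<close> is in the closure of the trace of \<open>V\<close>
  on \<open>D\<close>, and this closure is clopen and stays in \<open>C\<close>.\<close>

lemma clp_nbhd:
  assumes "openin X U" "p \<in> U"
  obtains A where "A \<subseteq> D" "p \<in> clp A" "clp A \<subseteq> U"
proof -
  have "regular_space X"
    using compact Hausdorff compact_Hausdorff_or_regular_imp_normal_space
    by (simp add: compact_Hausdorff_imp_regular_space)
  then have "neighbourhood_base_of (closedin X) X"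
    by (simp add: neighbourhood_base_of_closedin)
  then obtain V C where V: "openin X V" "closedin X C" "p \<in> V" "V \<subseteq> C" "C \<subseteq> U"
    using assms unfolding neighbourhood_base_of by meson
  define A where "A = {d \<in> D. e d \<in> V}"
  have eA: "e ` A = V \<inter> e ` D" by (auto simp: A_def)
  have "p \<in> clp A"
    unfolding clp_def eA
  proof (subst in_closure_of, intro conjI allI impI)
    show "p \<in> topspace X" using assms openin_subset by blast
    fix T assume "p \<in> T \<and> openin X T"
    then have T: "openin X (V \<inter> T)" "p \<in> V \<inter> T" using V by auto
    have "p \<in> X closure_of (e ` D)" using \<open>p \<in> topspace X\<close> dense by simp
    then obtain y where "y \<in> e ` D" "y \<in> V \<inter> T"
      using T by (meson in_closure_of)
    then show "\<exists>y. y \<in> V \<inter> e ` D \<and> y \<in> T" by blast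
  qed
  moreover have "clp A \<subseteq> U"
    using V closure_of_minimal[of "e ` A" C X] unfolding clp_def eA by blast
  moreover have "A \<subseteq> D" by (simp add: A_def)
  ultimately show ?thesis using that by blast
qed

text \<open>Finitely many of the neighbourhoods from \<open>clp_nbhd\<close> cover \<open>C\<close>,
  and a finite union of sets \<open>clp A\<close> has this form again. All separation arguments
  below go through this lemma.\<close>

lemma compactin_clp_interpolate:
  assumes "compactin X C" "openin X U" "C \<subseteq> U"
  obtains A where "A \<subseteq> D" "C \<subseteq> clp A" "clp A \<subseteq> U"
proof -
  let ?F = "clp ` {A. A \<subseteq> D \<and> clp A \<subseteq> U}"
  have "C \<subseteq> \<Union>?F"
  proof
    fix p assume "p \<in> C"
    then have "p \<in> U" using assms by blast
    obtain A where "A \<subseteq> D" "p \<in> clp A" "clp A \<subseteq> U"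
      using clp_nbhd[OF assms(2) \<open>p \<in> U\<close>] by blast
    then show "p \<in> \<Union>?F" by blast
  qed
  moreover have "\<And>V. V \<in> ?F \<Longrightarrow> openin X V" using clp_open by blast
  ultimately have "\<exists>\<F>. finite \<F> \<and> \<F> \<subseteq> ?F \<and> C \<subseteq> \<Union>\<F>"
    by (intro compactinD[OF assms(1)])
  then obtain \<F> where F: "finite \<F>" "\<F> \<subseteq> ?F" "C \<subseteq> \<Union>\<F>"
    by (elim exE conjE)
  from finite_subset_image[OF F(1,2)]
  obtain \<A> where A: "\<A> \<subseteq> {A. A \<subseteq> D \<and> clp A \<subseteq> U}" "finite \<A>" "\<F> = clp ` \<A>"
    by (elim exE conjE)
  have "clp (\<Union>\<A>) = \<Union>\<F>"
    using clp_UN_finite[OF A(2), of "\<lambda>x. x"] A(3) by simp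
  then show ?thesis using that[of "\<Union>\<A>"] A(1) A(3) F(3) by auto
qed

end

text \<open>Discreteness enters through one fact: the characteristic function of every
  \<open>A\<close> is continuous, hence a coordinate of the cube. That coordinate is 1 on the
  closure of \<open>A\<close> and 0 on the closure of \<open>D - A\<close>, so the two closures are
  complementary and therefore open.\<close>

lemma discrete_beta_stone_cech:
  fixes D :: "'a set"
  shows "discrete_beta (stone_cech (discrete_topology D)) D (beta_embed (discrete_topology D))"
proof -
  define T where "T = discrete_topology D"
  define I where "I = unit_functions T"
  define cube where "cube = product_topology (\<lambda>_::'a \<Rightarrow> real. top_of_set {0..1::real}) I"
  define e where "e = beta_embed T"
  define S where "S = cube closure_of (e ` D)"
  have X: "stone_cech T = subtopology cube S"
    by (simp add: stone_cech_def cube_def I_def S_def e_def T_def Let_def)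
  have tc: "topspace cube = (\<Pi>\<^sub>E f\<in>I. {0..1})"
    by (simp add: cube_def)
  have I_iff: "f \<in> I \<longleftrightarrow> f \<in> extensional D \<and> (\<forall>d\<in>D. f d \<in> {0..1})" for f
    by (auto simp: I_def T_def unit_functions_def)
  have e_apply: "f \<in> I \<Longrightarrow> e d f = f d" for f d
    by (simp add: e_def beta_embed_def I_def)
  have eD: "e ` D \<subseteq> topspace cube"
    using I_iff by (auto simp: tc e_def beta_embed_def I_def[symmetric] PiE_iff)
  have S: "S \<subseteq> topspace cube" "closedin cube S"
    by (simp_all add: S_def closure_of_subset_topspace)
  have tX: "topspace (stone_cech T) = S"
    using S(1) by (auto simp: X)
  have eS: "e ` D \<subseteq> S"
    using eD by (simp add: S_def closure_of_subset)
  have comp: "compact_space cube"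
    by (simp add: cube_def compact_space_product_topology compact_space_subtopology)
  have haus: "Hausdorff_space cube"
    by (simp add: cube_def Hausdorff_space_product_topology Hausdorff_space_subtopology)
  have clX: "stone_cech T closure_of (e ` A) = cube closure_of (e ` A)" if "A \<subseteq> D" for A
  proof -
    have "e ` A \<subseteq> S" using eS that by blast
    moreover have "cube closure_of (e ` A) \<subseteq> S"
      using that by (simp add: S_def closure_of_mono image_mono)
    ultimately show ?thesis
      by (simp add: X closure_of_subtopology Int_absorb1)
  qed
  show ?thesis
    unfolding T_def[symmetric] e_def[symmetric]
  proof
    show "compact_space (stone_cech T)"
      using closedin_compact_space[OF comp S(2)] by (simp add: X compact_space_subtopology)
    show "Hausdorff_space (stone_cech T)"
      by (simp add: X haus Hausdorff_space_subtopology)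
    show "stone_cech T closure_of e ` D = topspace (stone_cech T)"
      by (simp add: clX tX S_def)
    show "e ` D \<subseteq> topspace (stone_cech T)"
      by (simp add: tX eS)
  next
    fix A assume A: "A \<subseteq> D"
    define ch where "ch = (\<lambda>d\<in>D. if d \<in> A then 1 else 0 :: real)"
    have chI: "ch \<in> I" by (auto simp: I_iff ch_def)
    have cont: "continuous_map cube euclideanreal (\<lambda>p. p ch)"
      using continuous_map_product_projection[OF chI, of "\<lambda>_. top_of_set {0..1::real}"]
      unfolding cube_def by (simp add: continuous_map_in_subtopology)
    have cl: "stone_cech T closure_of e ` B \<subseteq> {p. p ch = c}"
      if "B \<subseteq> D" "\<And>d. d \<in> B \<Longrightarrow> ch d = c" for B c
    proof -
      have "closedin cube {p \<in> topspace cube. p ch \<in> {c}}"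
        using closedin_continuous_map_preimage[OF cont, of "{c}"] by simp
      moreover have "e ` B \<subseteq> {p \<in> topspace cube. p ch \<in> {c}}"
        using that eD by (auto simp: e_apply[OF chI])
      ultimately show ?thesis
        using closure_of_minimal unfolding clX[OF that(1)] by blast
    qed
    have clA: "stone_cech T closure_of e ` A \<subseteq> {p. p ch = 1}"
      by (rule cl) (use A in \<open>auto simp: ch_def\<close>)
    have clB: "stone_cech T closure_of e ` (D - A) \<subseteq> {p. p ch = 0}"
      by (rule cl) (use A in \<open>auto simp: ch_def\<close>)
    show disj: "stone_cech T closure_of e ` A \<inter> stone_cech T closure_of e ` (D - A) = {}"
      using clA clB by fastforce
    have "e ` D = e ` A \<union> e ` (D - A)" using A by blast
    then have "topspace (stone_cech T)
        = stone_cech T closure_of e ` A \<union> stone_cech T closure_of e ` (D - A)"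
      using clX[of D] tX S_def closure_of_Un by (metis order_refl)
    then have "stone_cech T closure_of e ` A
        = topspace (stone_cech T) - stone_cech T closure_of e ` (D - A)"
      using disj by blast
    then show "openin (stone_cech T) (stone_cech T closure_of e ` A)"
      by (metis closedin_closure_of openin_diff openin_topspace)
  qed
qed

section \<open>Radon measures on the compactification\<close>

text \<open>Nothing is said about values outside \<open>Pow D\<close>, so that total set functions
  and the extensional functions of a product over \<open>Pow D\<close> are treated alike.\<close>

definition prob_charge :: "'a set \<Rightarrow> ('a set \<Rightarrow> real) \<Rightarrow> bool" where
  "prob_charge D m \<longleftrightarrow> (\<forall>A\<subseteq>D. 0 \<le> m A) \<and> m D = 1 \<and>
     (\<forall>A B. A \<subseteq> D \<longrightarrow> B \<subseteq> D \<longrightarrow> A \<inter> B = {} \<longrightarrow> m (A \<union> B) = m A + m B)"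

lemma prob_chargeD:
  assumes "prob_charge D m"
  shows "A \<subseteq> D \<Longrightarrow> 0 \<le> m A" "m D = 1"
    "A \<subseteq> D \<Longrightarrow> B \<subseteq> D \<Longrightarrow> A \<inter> B = {} \<Longrightarrow> m (A \<union> B) = m A + m B"
  using assms unfolding prob_charge_def by blast+

lemma prob_charge_mono:
  assumes "prob_charge D m" "A \<subseteq> B" "B \<subseteq> D"
  shows "m A \<le> m B"
proof -
  have "m (A \<union> (B - A)) = m A + m (B - A)"
    using assms(2,3) by (intro prob_chargeD(3)[OF assms(1)]) auto
  moreover have "0 \<le> m (B - A)"
    using assms(2,3) by (intro prob_chargeD(1)[OF assms(1)]) auto
  moreover have "A \<union> (B - A) = B" using assms by blast
  ultimately show ?thesis by simp
qed

lemma prob_charge_le_1: "prob_charge D m \<Longrightarrow> A \<subseteq> D \<Longrightarrow> m A \<le> 1"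
  using prob_charge_mono[of D m A D] prob_chargeD(2)[of D m] by simp

section \<open>Borel sets and Radon probability measures on general spaces\<close>

lemma sets_borel_measure: "sets (borel_measure X) = sigma_sets (topspace X) {U. openin X U}"
  and space_borel_measure: "space (borel_measure X) = topspace X"
  unfolding borel_measure_def
  by (subst sets_measure_of space_measure_of; auto dest: openin_subset)+

lemma open_in_borel_measure: "openin X U \<Longrightarrow> U \<in> sets (borel_measure X)"
  by (simp add: sets_borel_measure)

lemma closed_in_borel_measure:
  assumes "closedin X C" shows "C \<in> sets (borel_measure X)"
proof -
  have "topspace X - (topspace X - C) \<in> sets (borel_measure X)"
    using assms unfolding sets_borel_measure
    by (intro sigma_sets.Compl sigma_sets.Basic) (simp add: closedin_def)
  moreover have "topspace X - (topspace X - C) = C"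
    using closedin_subset[OF assms] by blast
  ultimately show ?thesis by simp
qed

lemma continuous_map_borel_measurable:
  assumes "continuous_map X euclideanreal f"
  shows "f \<in> borel_measurable (borel_measure X)"
proof (rule borel_measurableI)
  fix S :: "real set" assume "open S"
  then have "openin X {x \<in> topspace X. f x \<in> S}"
    using openin_continuous_map_preimage[OF assms, of S] by simp
  then have "openin X (f -` S \<inter> space (borel_measure X))"
    by (simp add: space_borel_measure vimage_def Int_def conj_commute)
  then show "f -` S \<inter> space (borel_measure X) \<in> sets (borel_measure X)"
    by (rule open_in_borel_measure)
qed

lemma radon_probD:
  assumes "M \<in> radon_prob X"
  shows "prob_space M" "space M = topspace X" "sets M = sets (borel_measure X)"
  using assms by (auto simp: radon_prob_def)

lemma compactin_in_borel_measure:
  "Hausdorff_space X \<Longrightarrow> compactin X C \<Longrightarrow> C \<in> sets (borel_measure X)"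
  by (simp add: closed_in_borel_measure compactin_imp_closedin)

text \<open>Inner regularity in a real-valued \<epsilon>-form, in which approximations can be added
  and complemented without arithmetic on suprema in \<open>ennreal\<close>.\<close>

lemma radon_probI:
  assumes X: "Hausdorff_space X" and prob: "prob_space M"
    and M: "space M = topspace X" "sets M = sets (borel_measure X)"
    and approx: "\<And>A \<epsilon>. A \<in> sets M \<Longrightarrow> 0 < \<epsilon> \<Longrightarrow>
      \<exists>C. compactin X C \<and> C \<subseteq> A \<and> measure M A \<le> measure M C + \<epsilon>"
  shows "M \<in> radon_prob X"
proof -
  interpret prob_space M by (rule prob)
  have "emeasure M A = (SUP C\<in>{C. compactin X C \<and> C \<subseteq> A}. emeasure M C)" if A: "A \<in> sets M" for A
  proof (rule antisym)
    show "(SUP C\<in>{C. compactin X C \<and> C \<subseteq> A}. emeasure M C) \<le> emeasure M A"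
      using A by (intro SUP_least emeasure_mono) auto
    show "emeasure M A \<le> (SUP C\<in>{C. compactin X C \<and> C \<subseteq> A}. emeasure M C)"
    proof (rule ennreal_le_epsilon)
      fix \<epsilon> :: real assume \<epsilon>: "0 < \<epsilon>"
      from approx[OF A \<epsilon>] obtain C where
        C: "compactin X C" "C \<subseteq> A" "measure M A \<le> measure M C + \<epsilon>" by blast
      then have "emeasure M A \<le> emeasure M C + ennreal \<epsilon>"
        using \<epsilon> by (simp add: emeasure_eq_measure flip: ennreal_plus)
      also have "emeasure M C \<le> (SUP C\<in>{C. compactin X C \<and> C \<subseteq> A}. emeasure M C)"
        using C by (intro SUP_upper) auto
      finally show "emeasure M A \<le> (SUP C\<in>{C. compactin X C \<and> C \<subseteq> A}. emeasure M C) + ennreal \<epsilon>"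
        by (simp add: add_right_mono)
    qed
  qed
  then show ?thesis using prob M by (simp add: radon_prob_def)
qed

lemma radon_prob_approx:
  assumes M: "M \<in> radon_prob X" and A: "A \<in> sets M" and "0 < (\<epsilon>::real)"
  obtains C where "compactin X C" "C \<subseteq> A" "measure M A \<le> measure M C + \<epsilon>"
proof (cases "measure M A \<le> \<epsilon>")
  \<comment> \<open>Here \<open>measure M A - \<epsilon>\<close> would be truncated to 0 by
    \<open>ennreal\<close>, and a strict inequality may fail; the empty set is good enough.\<close>
  case True
  then show ?thesis using that[of "{}"] by simp
next
  case False
  interpret prob_space M using M by (rule radon_probD)
  have "ennreal (measure M A - \<epsilon>) < emeasure M A"
    using False assms(3) by (simp add: emeasure_eq_measure ennreal_less_iff)
  also have "emeasure M A = (SUP C\<in>{C. compactin X C \<and> C \<subseteq> A}. emeasure M C)"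
    using M A by (simp add: radon_prob_def)
  finally obtain C where "compactin X C" "C \<subseteq> A" "ennreal (measure M A - \<epsilon>) < emeasure M C"
    by (auto simp: less_SUP_iff)
  then show ?thesis
    using that[of C] False by (simp add: emeasure_eq_measure ennreal_less_iff)
qed

lemma dirac_radon:
  assumes X: "Hausdorff_space X" and x: "x \<in> topspace X"
  shows "return (borel_measure X) x \<in> radon_prob X"
proof (rule radon_probI[OF X])
  show "prob_space (return (borel_measure X) x)"
    using x by (intro prob_space_return) (simp add: space_borel_measure)
  fix A and \<epsilon> :: real
  assume "A \<in> sets (return (borel_measure X) x)" and "0 < \<epsilon>"
  then have A: "A \<in> sets (borel_measure X)" by simp
  show "\<exists>C. compactin X C \<and> C \<subseteq> A \<and>
      measure (return (borel_measure X) x) A \<le> measure (return (borel_measure X) x) C + \<epsilon>"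
  proof (cases "x \<in> A")
    case True
    then show ?thesis
      using x A \<open>0 < \<epsilon>\<close> compactin_in_borel_measure[OF X, of "{x}"]
      by (intro exI[of _ "{x}"]) (simp add: measure_return indicator_def)
  next
    case False
    then show ?thesis
      using A \<open>0 < \<epsilon>\<close> by (intro exI[of _ "{}"]) (simp add: measure_return)
  qed
qed (simp_all add: space_borel_measure)

text \<open>Inner regularity survives because one compact set, the union of the two approximating
  sets, serves both measures at once.\<close>

lemma radon_prob_convex:
  assumes X: "Hausdorff_space X" and M: "M \<in> radon_prob X" and N: "N \<in> radon_prob X"
    and t: "0 \<le> s" "0 \<le> t" "s + t = 1"
  shows "\<exists>R\<in>radon_prob X. measure R = (\<lambda>A. s * measure M A + t * measure N A)"
proof -
  interpret M: prob_space M using M by (rule radon_probD)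
  interpret N: prob_space N using N by (rule radon_probD)
  define \<mu> where "\<mu> A = ennreal s * emeasure M A + ennreal t * emeasure N A" for A
  define R where "R = measure_of (topspace X) (sets (borel_measure X)) \<mu>"
  have sM: "sets M = sets (borel_measure X)" and sN: "sets N = sets (borel_measure X)"
    using M N by (simp_all add: radon_probD)
  have sa: "sigma_algebra (topspace X) (sets (borel_measure X))"
    using sets.sigma_algebra_axioms[of "borel_measure X"] by (simp add: space_borel_measure)
  have sR: "sets R = sets (borel_measure X)" and spR: "space R = topspace X"
    using sa sets.space_closed[of "borel_measure X"]
    by (simp_all add: R_def space_borel_measure sigma_algebra.sigma_sets_eq)
  have pos: "positive (sets (borel_measure X)) \<mu>" by (simp add: positive_def \<mu>_def)
  have ca: "countably_additive (sets (borel_measure X)) \<mu>"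
  proof (rule countably_additiveI)
    fix A :: "nat \<Rightarrow> 'a set"
    assume A: "range A \<subseteq> sets (borel_measure X)" "disjoint_family A"
    show "(\<Sum>i. \<mu> (A i)) = \<mu> (\<Union>i. A i)"
      using suminf_emeasure[of A M] suminf_emeasure[of A N] A sM sN
      by (simp add: \<mu>_def suminf_add[symmetric] ennreal_suminf_cmult)
  qed
  have eR: "emeasure R A = ennreal (s * measure M A + t * measure N A)"
    if "A \<in> sets (borel_measure X)" for A
  proof -
    have "emeasure R A = \<mu> A"
      unfolding R_def by (rule emeasure_measure_of_sigma[OF sa pos ca that])
    also have "\<dots> = ennreal (s * measure M A + t * measure N A)"
      using t by (simp add: \<mu>_def M.emeasure_eq_measure N.emeasure_eq_measure ennreal_mult ennreal_plus)
    finally show ?thesis .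
  qed
  \<comment> \<open>Set functions are compared on all sets, not only on Borel sets; outside the
    \<sigma>-algebra all three measures are 0 by default.\<close>
  have mR: "measure R A = s * measure M A + t * measure N A" for A
  proof (cases "A \<in> sets (borel_measure X)")
    case True
    then show ?thesis using t by (intro measure_eq_emeasure_eq_ennreal eR) auto
  next
    case False
    then show ?thesis using sM sN sR by (simp add: measure_notin_sets)
  qed
  have "prob_space R"
    using eR[of "topspace X"] M.prob_space N.prob_space t radon_probD(2)[OF M] radon_probD(2)[OF N]
    by (intro prob_spaceI) (simp add: spR open_in_borel_measure flip: ennreal_plus)
  then have "R \<in> radon_prob X"
  proof (rule radon_probI[OF X _ spR sR])
    fix A and \<epsilon> :: real assume "A \<in> sets R" and \<epsilon>: "0 < \<epsilon>"
    then have A: "A \<in> sets M" "A \<in> sets N" using sR sM sN by auto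
    obtain B where B: "compactin X B" "B \<subseteq> A" "measure M A \<le> measure M B + \<epsilon>"
      using radon_prob_approx[OF M A(1) \<epsilon>] .
    obtain C where C: "compactin X C" "C \<subseteq> A" "measure N A \<le> measure N C + \<epsilon>"
      using radon_prob_approx[OF N A(2) \<epsilon>] .
    have BC: "B \<union> C \<in> sets M" "B \<union> C \<in> sets N"
      using B C by (auto simp: sM sN intro!: compactin_in_borel_measure[OF X] compactin_Un)
    have "measure M A \<le> measure M (B \<union> C) + \<epsilon>"
      using B(3) M.finite_measure_mono[of B "B \<union> C"] BC by simp
    moreover have "measure N A \<le> measure N (B \<union> C) + \<epsilon>"
      using C(3) N.finite_measure_mono[of C "B \<union> C"] BC by simp
    ultimately have "s * measure M A + t * measure N A
        \<le> s * (measure M (B \<union> C) + \<epsilon>) + t * (measure N (B \<union> C) + \<epsilon>)"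
      using t by (intro add_mono mult_left_mono)
    also have "\<dots> = s * measure M (B \<union> C) + t * measure N (B \<union> C) + (s + t) * \<epsilon>"
      by (simp add: algebra_simps)
    finally have "measure R A \<le> measure R (B \<union> C) + \<epsilon>"
      using t by (simp add: mR)
    then show "\<exists>C. compactin X C \<and> C \<subseteq> A \<and> measure R A \<le> measure R C + \<epsilon>"
      using B C by (intro exI[of _ "B \<union> C"]) (auto intro: compactin_Un)
  qed
  then show ?thesis using mR by blast
qed

section \<open>Extension of a finitely additive probability to a Radon measure\<close>

context discrete_beta
begin

context
  fixes m :: "'a set \<Rightarrow> real"
  assumes m: "prob_charge D m"
begin

text \<open>This and the next definition follow the proof of the Riesz representation theorem, with
  clopen sets in place of continuous functions: open sets are measured from inside, arbitrary sets
  from outside by open ones.\<close>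

definition open_content :: "'b set \<Rightarrow> ennreal" where
  "open_content U = (SUP A\<in>{A. A \<subseteq> D \<and> clp A \<subseteq> U}. ennreal (m A))"

definition outer_content :: "'b set \<Rightarrow> ennreal" where
  "outer_content E = (INF U\<in>{U. openin X U \<and> E \<subseteq> U}. open_content U)"

lemma open_content_upper: "A \<subseteq> D \<Longrightarrow> clp A \<subseteq> U \<Longrightarrow> ennreal (m A) \<le> open_content U"
  unfolding open_content_def by (rule SUP_upper) simp

lemma open_content_mono: "U \<subseteq> V \<Longrightarrow> open_content U \<le> open_content V"
  unfolding open_content_def by (rule SUP_subset_mono) auto

lemma open_content_clp:
  assumes "A \<subseteq> D" shows "open_content (clp A) = ennreal (m A)"
proof (rule antisym)
  show "open_content (clp A) \<le> ennreal (m A)"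
    unfolding open_content_def
  proof (rule SUP_least)
    fix B assume "B \<in> {B. B \<subseteq> D \<and> clp B \<subseteq> clp A}"
    then have "B \<subseteq> A" using assms clp_subset_iff[of B A] by simp
    then show "ennreal (m B) \<le> ennreal (m A)"
      using assms by (intro ennreal_leI prob_charge_mono[OF m])
  qed
qed (use assms open_content_upper in blast)

lemma m_empty: "m {} = 0"
  using prob_chargeD(3)[OF m, of "{}" "{}"] by simp

lemma open_content_empty: "open_content {} = 0"
  using open_content_clp[of "{}"] by (simp add: m_empty)

lemma open_content_le_1: "open_content U \<le> 1"
  unfolding open_content_def
  by (rule SUP_least) (auto intro: prob_charge_le_1[OF m])

text \<open>A clopen subset of the union splits along a clopen set: interpolate \<open>clp B\<close>
  between the compact set \<open>clp A - V\<close> and \<open>U\<close>; then what remains,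
  \<open>clp (A - B)\<close>, lies in \<open>V\<close>.\<close>

lemma open_content_Un:
  assumes "openin X U" "openin X V"
  shows "open_content (U \<union> V) \<le> open_content U + open_content V"
  unfolding open_content_def[of "U \<union> V"]
proof (rule SUP_least)
  fix A assume "A \<in> {A. A \<subseteq> D \<and> clp A \<subseteq> U \<union> V}"
  then have A: "A \<subseteq> D" "clp A \<subseteq> U \<union> V" by auto
  have "compactin X (clp A - V)"
    by (intro closedin_compact_space[OF compact] closedin_diff clp_closed assms)
  moreover have "clp A - V \<subseteq> U" using A by blast
  ultimately obtain B where B: "B \<subseteq> D" "clp A - V \<subseteq> clp B" "clp B \<subseteq> U"
    using compactin_clp_interpolate assms(1) by metis
  have AB: "clp (A - B) \<subseteq> V"
  proof -
    have "clp (A - B) \<subseteq> clp A" using clp_mono[of "A - B" A] by simp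
    moreover have "clp (A - B) \<inter> clp B = {}" using A B by (intro clp_disjoint) auto
    ultimately show ?thesis using B by blast
  qed
  have "m A \<le> m (B \<union> (A - B))"
    using A B by (intro prob_charge_mono[OF m]) auto
  also have "\<dots> = m B + m (A - B)"
    using A B by (intro prob_chargeD(3)[OF m]) auto
  finally have "ennreal (m A) \<le> ennreal (m B + m (A - B))" by (rule ennreal_leI)
  also have "\<dots> = ennreal (m B) + ennreal (m (A - B))"
    using A B by (intro ennreal_plus prob_chargeD(1)[OF m]) auto
  also have "\<dots> \<le> open_content U + open_content V"
    using A B AB by (intro add_mono open_content_upper) auto
  finally show "ennreal (m A) \<le> open_content U + open_content V" .
qed

lemma open_content_UN_lessThan:
  assumes "\<And>i. openin X (U i)"
  shows "open_content (\<Union>i<n::nat. U i) \<le> (\<Sum>i<n. open_content (U i))"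
proof (induction n)
  case 0
  then show ?case by (simp add: open_content_empty)
next
  case (Suc n)
  have "open_content (\<Union>i<Suc n. U i) = open_content ((\<Union>i<n. U i) \<union> U n)"
    by (simp add: lessThan_Suc Un_commute)
  also have "\<dots> \<le> open_content (\<Union>i<n. U i) + open_content (U n)"
    using assms by (intro open_content_Un) auto
  also have "\<dots> \<le> (\<Sum>i<Suc n. open_content (U i))"
    using Suc by (simp add: add_right_mono)
  finally show ?case .
qed

text \<open>A clopen subset of the union is compact, so it already lies in a finite union, where
  finite subadditivity applies.\<close>

lemma open_content_UN:
  fixes U :: "nat \<Rightarrow> 'b set"
  assumes "\<And>i. openin X (U i)"
  shows "open_content (\<Union>i. U i) \<le> (\<Sum>i. open_content (U i))"
  unfolding open_content_def[of "\<Union>i. U i"]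
proof (rule SUP_least)
  fix A assume "A \<in> {A. A \<subseteq> D \<and> clp A \<subseteq> (\<Union>i. U i)}"
  then have A: "A \<subseteq> D" "clp A \<subseteq> \<Union>(range U)" by auto
  have "\<exists>\<F>. finite \<F> \<and> \<F> \<subseteq> range U \<and> clp A \<subseteq> \<Union>\<F>"
    by (rule compactinD[OF compactin_clp]) (use A assms in auto)
  then obtain \<F> where F: "finite \<F>" "\<F> \<subseteq> range U" "clp A \<subseteq> \<Union>\<F>"
    by (elim exE conjE)
  from finite_subset_image[OF F(1,2)]
  obtain J where J: "finite J" "\<F> = U ` J" by (elim exE conjE)
  obtain n where n: "J \<subseteq> {..<n}" using finite_nat_iff_bounded[of J] J(1) by blast
  have "clp A \<subseteq> (\<Union>i<n. U i)" using F(3) J(2) n by blast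
  then have "ennreal (m A) \<le> open_content (\<Union>i<n. U i)"
    by (rule open_content_upper[OF A(1)])
  also have "\<dots> \<le> (\<Sum>i<n. open_content (U i))"
    by (rule open_content_UN_lessThan[OF assms])
  also have "\<dots> \<le> (\<Sum>i. open_content (U i))"
    by (rule sum_le_suminf) auto
  finally show "ennreal (m A) \<le> (\<Sum>i. open_content (U i))" .
qed

lemma outer_content_lower: "openin X U \<Longrightarrow> E \<subseteq> U \<Longrightarrow> outer_content E \<le> open_content U"
  unfolding outer_content_def by (rule INF_lower) simp

lemma outer_content_open: "openin X U \<Longrightarrow> outer_content U = open_content U"
  by (rule antisym, rule outer_content_lower)
    (auto simp: outer_content_def intro!: INF_greatest open_content_mono)

lemma outer_content_mono: "E \<subseteq> F \<Longrightarrow> outer_content E \<le> outer_content F"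
  unfolding outer_content_def by (rule INF_superset_mono) auto

lemma outer_content_clp: "A \<subseteq> D \<Longrightarrow> outer_content (clp A) = ennreal (m A)"
  by (simp add: outer_content_open clp_open open_content_clp)

lemma outer_content_le_1: "E \<subseteq> topspace X \<Longrightarrow> outer_content E \<le> 1"
  using outer_content_lower[of "topspace X" E] open_content_le_1[of "topspace X"] by auto

lemma outer_content_approx:
  assumes "E \<subseteq> topspace X" "0 < (\<epsilon>::real)"
  obtains U where "openin X U" "E \<subseteq> U" "open_content U \<le> outer_content E + ennreal \<epsilon>"
proof -
  \<comment> \<open>The inequality is strict because the outer content of a subset of the space is
    finite.\<close>
  have "outer_content E < outer_content E + ennreal \<epsilon>"
    using outer_content_le_1[OF assms(1)] assms(2)
    by (cases "outer_content E") (auto simp: ennreal_less_iff top_unique simp flip: ennreal_plus)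
  then show ?thesis
    using that unfolding outer_content_def INF_less_iff by (auto intro: less_imp_le)
qed

lemma outer_measure_space_outer_content:
  "outer_measure_space (Pow (topspace X)) outer_content"
  unfolding outer_measure_space_def
proof (intro conjI)
  show "positive (Pow (topspace X)) outer_content"
    by (simp add: positive_def outer_content_open open_content_empty)
  show "increasing (Pow (topspace X)) outer_content"
    by (simp add: increasing_def outer_content_mono)
  show "countably_subadditive (Pow (topspace X)) outer_content"
    unfolding countably_subadditive_def
  proof (intro allI impI)
    fix E :: "nat \<Rightarrow> 'b set"
    assume "range E \<subseteq> Pow (topspace X)"
    then have E: "E i \<subseteq> topspace X" for i by auto
    show "outer_content (\<Union>i. E i) \<le> (\<Sum>i. outer_content (E i))"
    proof (rule ennreal_le_epsilon)
      fix \<epsilon> :: real assume "0 < \<epsilon>"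
      \<comment> \<open>With exponents starting at 1 the errors add up to exactly
        \<epsilon>.\<close>
      then have "0 < \<epsilon> * (1/2) ^ Suc i" for i by simp
      then have "\<exists>U. openin X U \<and> E i \<subseteq> U \<and>
          open_content U \<le> outer_content (E i) + ennreal (\<epsilon> * (1/2) ^ Suc i)" for i
        using outer_content_approx[OF E] by metis
      then obtain U where U: "\<And>i. openin X (U i)" "\<And>i. E i \<subseteq> U i"
          "\<And>i. open_content (U i) \<le> outer_content (E i) + ennreal (\<epsilon> * (1/2) ^ Suc i)"
        by metis
      have "outer_content (\<Union>i. E i) \<le> open_content (\<Union>i. U i)"
        using U by (intro outer_content_lower) auto
      also have "\<dots> \<le> (\<Sum>i. open_content (U i))"
        by (rule open_content_UN[OF U(1)])
      also have "\<dots> \<le> (\<Sum>i. outer_content (E i) + ennreal (\<epsilon> * (1/2) ^ Suc i))"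
        by (intro suminf_le U(3)) auto
      also have "\<dots> = (\<Sum>i. outer_content (E i)) + (\<Sum>i. ennreal (\<epsilon> * (1/2) ^ Suc i))"
        by (rule suminf_add[symmetric]) auto
      also have "(\<Sum>i. ennreal (\<epsilon> * (1/2) ^ Suc i)) = ennreal \<epsilon>"
        using \<open>0 < \<epsilon>\<close> sums_mult[OF power_half_series, of \<epsilon>]
        by (subst suminf_ennreal_eq) auto
      finally show "outer_content (\<Union>i. E i) \<le> (\<Sum>i. outer_content (E i)) + ennreal \<epsilon>" .
    qed
  qed
qed

text \<open>The nontrivial half of the Caratheodory condition for an open test set. Exhaust
  \<open>U \<inter> W\<close> by some \<open>clp A\<close>, then exhaust the open set
  \<open>W - clp A\<close>, which contains \<open>W - U\<close>, by some \<open>clp B\<close>. As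
  \<open>A\<close> and \<open>B\<close> are disjoint, additivity gives the bound by
  \<open>clp (A \<union> B)\<close> inside \<open>W\<close>.\<close>

lemma open_content_split:
  assumes "openin X U" "openin X W"
  shows "open_content (U \<inter> W) + outer_content (W - U) \<le> open_content W"
proof -
  have ne: "{A. A \<subseteq> D \<and> clp A \<subseteq> V} \<noteq> {}" for V
    using clp_empty by blast
  have "open_content (U \<inter> W) + outer_content (W - U)
      = (SUP A\<in>{A. A \<subseteq> D \<and> clp A \<subseteq> U \<inter> W}. ennreal (m A) + outer_content (W - U))"
    unfolding open_content_def[of "U \<inter> W"] using ne by (rule ennreal_SUP_add_left[symmetric])
  also have "\<dots> \<le> open_content W"
  proof (rule SUP_least)
    fix A assume "A \<in> {A. A \<subseteq> D \<and> clp A \<subseteq> U \<inter> W}"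
    then have A: "A \<subseteq> D" "clp A \<subseteq> U \<inter> W" by auto
    have "outer_content (W - U) \<le> open_content (W - clp A)"
      using A by (intro outer_content_lower openin_diff assms clp_closed) auto
    then have "ennreal (m A) + outer_content (W - U) \<le> ennreal (m A) + open_content (W - clp A)"
      by (rule add_left_mono)
    also have "\<dots> = (SUP B\<in>{B. B \<subseteq> D \<and> clp B \<subseteq> W - clp A}. ennreal (m A) + ennreal (m B))"
      unfolding open_content_def[of "W - clp A"] by (rule ennreal_SUP_add_right[OF ne])
    also have "\<dots> \<le> open_content W"
    proof (rule SUP_least)
      fix B assume "B \<in> {B. B \<subseteq> D \<and> clp B \<subseteq> W - clp A}"
      then have B: "B \<subseteq> D" "clp B \<subseteq> W - clp A" by auto
      have "clp (A \<inter> B) = {}" using A B by (auto simp: clp_Int)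
      then have "A \<inter> B = {}" using clp_nonempty[of "A \<inter> B"] A by blast
      then have "ennreal (m A) + ennreal (m B) = ennreal (m (A \<union> B))"
        using A B by (simp add: prob_chargeD[OF m])
      also have "\<dots> \<le> open_content W"
        using A B by (intro open_content_upper) (auto simp: clp_Un)
      finally show "ennreal (m A) + ennreal (m B) \<le> open_content W" .
    qed
    finally show "ennreal (m A) + outer_content (W - U) \<le> open_content W" .
  qed
  finally show ?thesis .
qed

text \<open>Open test sets suffice: the outer content of \<open>E\<close> is the infimum over the
  open \<open>W\<close> containing \<open>E\<close>, and the parts of \<open>E\<close> lie in the
  corresponding parts of \<open>W\<close>.\<close>

lemma open_in_lambda_system:
  assumes "openin X U"
  shows "U \<in> lambda_system (topspace X) (Pow (topspace X)) outer_content"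
  unfolding lambda_system_def
proof (intro CollectI conjI ballI)
  show "U \<in> Pow (topspace X)" using assms openin_subset by blast
  fix E assume "E \<in> Pow (topspace X)"
  then have E: "E \<subseteq> topspace X" by simp
  show "outer_content (U \<inter> E) + outer_content ((topspace X - U) \<inter> E) = outer_content E"
  proof (rule antisym)
    show "outer_content (U \<inter> E) + outer_content ((topspace X - U) \<inter> E) \<le> outer_content E"
      unfolding outer_content_def[of E]
    proof (rule INF_greatest)
      fix W assume "W \<in> {W. openin X W \<and> E \<subseteq> W}"
      then have W: "openin X W" "E \<subseteq> W" by auto
      have "outer_content (U \<inter> E) + outer_content ((topspace X - U) \<inter> E)
          \<le> open_content (U \<inter> W) + outer_content (W - U)"
        using W assms by (intro add_mono outer_content_lower outer_content_mono) auto
      also have "\<dots> \<le> open_content W" by (rule open_content_split[OF assms W(1)])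
      finally show "outer_content (U \<inter> E) + outer_content ((topspace X - U) \<inter> E) \<le> open_content W" .
    qed
    have "countably_subadditive (Pow (topspace X)) outer_content" "positive (Pow (topspace X)) outer_content"
      using outer_measure_space_outer_content by (auto simp: outer_measure_space_def)
    then have "subadditive (Pow (topspace X)) outer_content"
      by (intro ring_of_sets.countably_subadditive_subadditive[of "topspace X"] ring_of_sets_Pow)
    then have "outer_content ((U \<inter> E) \<union> ((topspace X - U) \<inter> E))
        \<le> outer_content (U \<inter> E) + outer_content ((topspace X - U) \<inter> E)"
      using E by (intro subadditiveD) auto
    moreover have "(U \<inter> E) \<union> ((topspace X - U) \<inter> E) = E" using E by blast
    ultimately show "outer_content E \<le> outer_content (U \<inter> E) + outer_content ((topspace X - U) \<inter> E)"
      by simp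
  qed
qed

lemma measure_space_outer_content:
  "measure_space (topspace X) (sets (borel_measure X)) outer_content"
proof -
  have L: "measure_space (topspace X)
      (lambda_system (topspace X) (Pow (topspace X)) outer_content) outer_content"
    by (rule sigma_algebra.caratheodory_lemma[OF sigma_algebra_Pow outer_measure_space_outer_content])
  then have "sigma_algebra (topspace X) (lambda_system (topspace X) (Pow (topspace X)) outer_content)"
    by (simp add: measure_space_def)
  then have "sets (borel_measure X) \<subseteq> lambda_system (topspace X) (Pow (topspace X)) outer_content"
    unfolding sets_borel_measure
    by (rule sigma_algebra.sigma_sets_subset) (auto intro: open_in_lambda_system)
  with L show ?thesis
    using measure_down sets.sigma_algebra_axioms[of "borel_measure X"] space_borel_measure[of X]
    by metis
qed

text \<open>Outer regularity is built into \<open>outer_content\<close>. Complements in the compact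
  space turn it into inner regularity: an open set tightly around the complement of \<open>A\<close>
  leaves a compact set that nearly fills \<open>A\<close>.\<close>

lemma radon_extension: "\<exists>M\<in>radon_prob X. \<forall>A\<subseteq>D. measure M (clp A) = m A"
proof -
  define M where "M = measure_of (topspace X) (sets (borel_measure X)) outer_content"
  have ms: "sigma_algebra (topspace X) (sets (borel_measure X))"
      "positive (sets (borel_measure X)) outer_content"
      "countably_additive (sets (borel_measure X)) outer_content"
    using measure_space_outer_content by (auto simp: measure_space_def)
  have sM: "sets M = sets (borel_measure X)" and spM: "space M = topspace X"
    using ms(1) sets.space_closed[of "borel_measure X"]
    by (simp_all add: M_def space_borel_measure sigma_algebra.sigma_sets_eq)
  have eM: "emeasure M A = outer_content A" if "A \<in> sets (borel_measure X)" for A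
    unfolding M_def by (rule emeasure_measure_of_sigma[OF ms that])
  have clpM: "emeasure M (clp A) = ennreal (m A)" if "A \<subseteq> D" for A
    using that by (subst eM) (auto simp: outer_content_clp open_in_borel_measure clp_open)
  have one: "emeasure M (topspace X) = 1"
    using clpM[of D] by (simp add: clp_D prob_chargeD(2)[OF m])
  then have prob: "prob_space M"
    by (intro prob_spaceI) (simp add: spM)
  interpret prob_space M by (rule prob)
  have "M \<in> radon_prob X"
  proof (rule radon_probI[OF Hausdorff prob spM sM])
    fix A and \<epsilon> :: real assume A: "A \<in> sets M" and \<epsilon>: "0 < \<epsilon>"
    have "topspace X - A \<subseteq> topspace X" by simp
    from outer_content_approx[OF this \<epsilon>] obtain U where
      U: "openin X U" "topspace X - A \<subseteq> U"
        "open_content U \<le> outer_content (topspace X - A) + ennreal \<epsilon>" .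
    have Us: "U \<in> sets M" using U(1) by (simp add: sM open_in_borel_measure)
    have As: "topspace X - A \<in> sets M" using A spM sets.compl_sets by metis
    have "emeasure M U \<le> emeasure M (topspace X - A) + ennreal \<epsilon>"
      using U Us As by (simp add: eM sM outer_content_open)
    then have "measure M U \<le> measure M (topspace X - A) + \<epsilon>"
      using \<epsilon> by (simp add: emeasure_eq_measure flip: ennreal_plus)
    also have "measure M (topspace X - A) = 1 - measure M A"
      using prob_compl[OF A] by (simp add: spM)
    finally have "measure M A \<le> measure M (topspace X - U) + \<epsilon>"
      using prob_compl[OF Us] by (simp add: spM)
    moreover have "compactin X (topspace X - U)"
      using U(1) by (intro closedin_compact_space[OF compact]) auto
    ultimately show "\<exists>C. compactin X C \<and> C \<subseteq> A \<and> measure M A \<le> measure M C + \<epsilon>"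
      using U(2) by blast
  qed
  moreover have "measure M (clp A) = m A" if "A \<subseteq> D" for A
    using clpM[OF that] prob_chargeD(1)[OF m that] by (simp add: measure_def)
  ultimately show ?thesis by blast
qed

end

section \<open>Radon measures are determined by their values at clopen sets\<close>

lemma clp_sets: "M \<in> radon_prob X \<Longrightarrow> clp A \<in> sets M"
  by (simp add: radon_probD clp_closed closed_in_borel_measure)

lemma prob_charge_radon:
  assumes "M \<in> radon_prob X"
  shows "prob_charge D (\<lambda>A. measure M (clp A))"
proof -
  interpret prob_space M using assms by (rule radon_probD)
  show ?thesis
    unfolding prob_charge_def
  proof (intro conjI allI impI)
    show "measure M (clp D) = 1"
      using prob_space by (simp add: clp_D radon_probD(2)[OF assms])
    fix A B assume "A \<subseteq> D" "B \<subseteq> D" "A \<inter> B = {}"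
    then show "measure M (clp (A \<union> B)) = measure M (clp A) + measure M (clp B)"
      unfolding clp_Un by (intro finite_measure_Union clp_sets[OF assms] clp_disjoint)
  qed simp
qed

text \<open>By interpolation, a compact subset of an open \<open>U\<close> lies in a clopen subset
  of \<open>U\<close>. So inner regularity recovers the measure of \<open>U\<close> from clopen
  sets, and the open sets form an intersection-stable generator of the Borel sets.\<close>

lemma radon_prob_eqI:
  assumes M: "M \<in> radon_prob X" and N: "N \<in> radon_prob X"
    and eq: "\<And>A. A \<subseteq> D \<Longrightarrow> measure M (clp A) = measure N (clp A)"
  shows "M = N"
proof -
  interpret M: prob_space M using M by (rule radon_probD)
  interpret N: prob_space N using N by (rule radon_probD)
  have em: "emeasure M (clp A) = emeasure N (clp A)" if "A \<subseteq> D" for A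
    using eq[OF that] by (simp add: M.emeasure_eq_measure N.emeasure_eq_measure)
  have rep: "emeasure R U = (SUP A\<in>{A. A \<subseteq> D \<and> clp A \<subseteq> U}. emeasure R (clp A))"
    if R: "R \<in> radon_prob X" and U: "openin X U" for R U
  proof (rule antisym)
    have Us: "U \<in> sets R" using U R by (simp add: radon_probD open_in_borel_measure)
    then show "(SUP A\<in>{A. A \<subseteq> D \<and> clp A \<subseteq> U}. emeasure R (clp A)) \<le> emeasure R U"
      by (intro SUP_least emeasure_mono) auto
    have "emeasure R U = (SUP C\<in>{C. compactin X C \<and> C \<subseteq> U}. emeasure R C)"
      using R Us by (simp add: radon_prob_def)
    also have "\<dots> \<le> (SUP A\<in>{A. A \<subseteq> D \<and> clp A \<subseteq> U}. emeasure R (clp A))"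
    proof (rule SUP_mono)
      fix C assume "C \<in> {C. compactin X C \<and> C \<subseteq> U}"
      then obtain A where "A \<subseteq> D" "C \<subseteq> clp A" "clp A \<subseteq> U"
        using compactin_clp_interpolate[OF _ U] by blast
      then show "\<exists>A\<in>{A. A \<subseteq> D \<and> clp A \<subseteq> U}. emeasure R C \<le> emeasure R (clp A)"
        using clp_sets[OF R] by (auto intro!: emeasure_mono)
    qed
    finally show "emeasure R U \<le> (SUP A\<in>{A. A \<subseteq> D \<and> clp A \<subseteq> U}. emeasure R (clp A))" .
  qed
  show ?thesis
  proof (rule measure_eqI_generator_eq[where E = "{U. openin X U}" and \<Omega> = "topspace X"
        and A = "\<lambda>_. topspace X"])
    show "Int_stable {U. openin X U}" by (auto simp: Int_stable_def)
    show "{U. openin X U} \<subseteq> Pow (topspace X)" by (auto dest: openin_subset)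
    show "sets M = sigma_sets (topspace X) {U. openin X U}"
      "sets N = sigma_sets (topspace X) {U. openin X U}"
      using M N by (simp_all add: radon_probD sets_borel_measure)
    show "emeasure M U = emeasure N U" if "U \<in> {U. openin X U}" for U
      using that by (simp add: rep[OF M] rep[OF N] em cong: SUP_cong_simp)
  qed auto
qed

end

section \<open>Topologies generated by linear functionals\<close>

text \<open>The initial (weak) topology of the functionals \<open>L i\<close>. As a pullback of a
  product it inherits basic neighbourhoods and compactness from there; with the carrier
  \<open>V\<close> as a parameter, passing to a subspace just means shrinking
  \<open>V\<close>.\<close>

definition functional_topology :: "'v set \<Rightarrow> 'i set \<Rightarrow> ('i \<Rightarrow> 'v \<Rightarrow> real) \<Rightarrow> 'v topology" where
  "functional_topology V I L =
     pullback_topology V (\<lambda>v. \<lambda>i\<in>I. L i v) (product_topology (\<lambda>_. euclideanreal) I)"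

lemma topspace_functional_topology [simp]: "topspace (functional_topology V I L) = V"
  by (auto simp: functional_topology_def topspace_pullback_topology)

lemma subtopology_functional_topology:
  assumes "S \<subseteq> V"
  shows "subtopology (functional_topology V I L) S = functional_topology S I L"
proof -
  have "f -` U \<inter> V \<inter> S = f -` U \<inter> S" for f :: "'a \<Rightarrow> 'b \<Rightarrow> real" and U
    using assms by blast
  then have "(\<exists>T. (\<exists>U. P U \<and> T = f -` U \<inter> V) \<and> W = T \<inter> S) \<longleftrightarrow> (\<exists>U. P U \<and> W = f -` U \<inter> S)"
    for f :: "'a \<Rightarrow> 'b \<Rightarrow> real" and P W by metis
  then show ?thesis
    unfolding topology_eq functional_topology_def openin_subtopology openin_pullback_topology
    by (intro allI)
qed

lemma continuous_map_functional:
  assumes "i \<in> I" shows "continuous_map (functional_topology V I L) euclideanreal (L i)"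
proof -
  have "continuous_map (functional_topology V I L) euclideanreal ((\<lambda>g. g i) \<circ> (\<lambda>v. \<lambda>i\<in>I. L i v))"
    unfolding functional_topology_def
    by (intro continuous_map_pullback continuous_map_product_projection assms)
  then show ?thesis using assms by (simp add: o_def)
qed

lemma continuous_map_into_functional_topology:
  assumes "f \<in> topspace T \<rightarrow> V" "\<And>i. i \<in> I \<Longrightarrow> continuous_map T euclideanreal (\<lambda>x. L i (f x))"
  shows "continuous_map T (functional_topology V I L) f"
  unfolding functional_topology_def
proof (rule continuous_map_pullback')
  show "continuous_map T (product_topology (\<lambda>_. euclideanreal) I) ((\<lambda>v. \<lambda>i\<in>I. L i v) \<circ> f)"
    using assms(2) by (auto simp: continuous_map_componentwise o_def)
qed (use assms(1) in auto)

lemma functional_topology_nbhd: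
  assumes "openin (functional_topology V I L) U" "v \<in> U"
  obtains F \<epsilon> where "finite F" "F \<subseteq> I" "0 < \<epsilon>" "{w \<in> V. \<forall>i\<in>F. \<bar>L i w - L i v\<bar> < \<epsilon>} \<subseteq> U"
proof -
  obtain W where W: "openin (product_topology (\<lambda>_. euclideanreal) I) W"
      "U = (\<lambda>v. \<lambda>i\<in>I. L i v) -` W \<inter> V"
    using assms(1) unfolding functional_topology_def openin_pullback_topology by blast
  then have "(\<lambda>i\<in>I. L i v) \<in> W" using assms(2) by blast
  with W(1) have "\<exists>B. finite {i \<in> I. B i \<noteq> topspace euclideanreal} \<and>
      (\<forall>i\<in>I. openin euclideanreal (B i)) \<and> (\<lambda>i\<in>I. L i v) \<in> Pi\<^sub>E I B \<and> Pi\<^sub>E I B \<subseteq> W"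
    unfolding openin_product_topology_alt by (elim bspec)
  then obtain B where B: "finite {i \<in> I. B i \<noteq> topspace euclideanreal}"
      "\<And>i. i \<in> I \<Longrightarrow> openin euclideanreal (B i)"
      "(\<lambda>i\<in>I. L i v) \<in> Pi\<^sub>E I B" "Pi\<^sub>E I B \<subseteq> W"
    by blast
  define F where "F = {i \<in> I. B i \<noteq> UNIV}"
  have fin: "finite F" using B(1) by (simp add: F_def)
  have "\<exists>\<epsilon>>0. ball (L i v) \<epsilon> \<subseteq> B i" if "i \<in> F" for i
  proof -
    have "open (B i)" "L i v \<in> B i"
      using B(2)[of i] B(3) that by (auto simp: F_def PiE_iff)
    then show ?thesis by (simp add: open_contains_ball)
  qed
  then obtain r where r: "\<And>i. i \<in> F \<Longrightarrow> 0 < r i" "\<And>i. i \<in> F \<Longrightarrow> ball (L i v) (r i) \<subseteq> B i"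
    by metis
  \<comment> \<open>The inserted 1 keeps the minimum meaningful and positive when \<open>F\<close>
    is empty.\<close>
  define \<epsilon> where "\<epsilon> = Min (insert 1 (r ` F))"
  have \<epsilon>: "0 < \<epsilon>" "\<And>i. i \<in> F \<Longrightarrow> \<epsilon> \<le> r i"
    using fin r(1) by (auto simp: \<epsilon>_def)
  have "{w \<in> V. \<forall>i\<in>F. \<bar>L i w - L i v\<bar> < \<epsilon>} \<subseteq> U"
  proof
    fix w assume "w \<in> {w \<in> V. \<forall>i\<in>F. \<bar>L i w - L i v\<bar> < \<epsilon>}"
    then have w: "w \<in> V" "\<And>i. i \<in> F \<Longrightarrow> \<bar>L i w - L i v\<bar> < \<epsilon>" by auto
    have "L i w \<in> B i" if "i \<in> I" for i
    proof (cases "i \<in> F")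
      case True
      then have "L i w \<in> ball (L i v) (r i)"
        using w(2)[of i] \<epsilon>(2)[of i] by (simp add: dist_real_def abs_minus_commute)
      then show ?thesis using r(2)[OF True] by blast
    next
      case False
      then show ?thesis using that by (simp add: F_def)
    qed
    then have "(\<lambda>i\<in>I. L i w) \<in> Pi\<^sub>E I B" by auto
    then show "w \<in> U" using B(4) W(2) w(1) by blast
  qed
  then show ?thesis using that[of F \<epsilon>] fin \<epsilon>(1) by (auto simp: F_def)
qed

lemma Hausdorff_functional_topology:
  assumes "\<And>v w. v \<in> V \<Longrightarrow> w \<in> V \<Longrightarrow> (\<And>i. i \<in> I \<Longrightarrow> L i v = L i w) \<Longrightarrow> v = w"
  shows "Hausdorff_space (functional_topology V I L)"
proof (rule Hausdorff_space_injective_preimage)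
  show "continuous_map (functional_topology V I L) (product_topology (\<lambda>_. euclideanreal) I)
      (\<lambda>v. \<lambda>i\<in>I. L i v)"
    by (auto simp: continuous_map_componentwise continuous_map_functional)
  show "Hausdorff_space (product_topology (\<lambda>_. euclideanreal) I)"
    by (simp add: Hausdorff_space_product_topology)
  show "inj_on (\<lambda>v. \<lambda>i\<in>I. L i v) (topspace (functional_topology V I L))"
  proof (rule inj_onI)
    fix v w assume "v \<in> topspace (functional_topology V I L)" "w \<in> topspace (functional_topology V I L)"
      "(\<lambda>i\<in>I. L i v) = (\<lambda>i\<in>I. L i w)"
    then show "v = w" by (intro assms) (auto dest: fun_cong simp: restrict_def split: if_splits)
  qed
qed

text \<open>Every open set is the preimage of an open set of the product, so a cover of
  \<open>V\<close> lifts to a cover of the compact image, and a finite subcover there pulls back to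
  one of \<open>V\<close>.\<close>

lemma compact_functional_topology:
  assumes "compactin (product_topology (\<lambda>_. euclideanreal) I) ((\<lambda>v. \<lambda>i\<in>I. L i v) ` V)"
  shows "compact_space (functional_topology V I L)"
  unfolding compact_space_alt topspace_functional_topology
proof (intro allI impI)
  let ?\<Phi> = "\<lambda>v. \<lambda>i\<in>I. L i v"
  fix \<U> assume "(\<forall>U\<in>\<U>. openin (functional_topology V I L) U) \<and> V \<subseteq> \<Union>\<U>"
  then have U: "\<forall>U\<in>\<U>. openin (functional_topology V I L) U" and cover: "V \<subseteq> \<Union>\<U>" by simp_all
  define \<W> where "\<W> = {W. openin (product_topology (\<lambda>_. euclideanreal) I) W \<and> ?\<Phi> -` W \<inter> V \<in> \<U>}"
  have "\<exists>\<F>. finite \<F> \<and> \<F> \<subseteq> \<W> \<and> ?\<Phi> ` V \<subseteq> \<Union>\<F>"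
  proof (rule compactinD[OF assms])
    show "?\<Phi> ` V \<subseteq> \<Union>\<W>"
    proof
      fix y assume "y \<in> ?\<Phi> ` V"
      then obtain v where v: "v \<in> V" "y = ?\<Phi> v" by (elim imageE)
      obtain T where T: "T \<in> \<U>" "v \<in> T" using cover v(1) by blast
      then have "openin (functional_topology V I L) T" using U by simp
      then obtain W where W: "openin (product_topology (\<lambda>_. euclideanreal) I) W" "T = ?\<Phi> -` W \<inter> V"
        unfolding functional_topology_def openin_pullback_topology by (elim exE conjE)
      then have "W \<in> \<W>" using T by (simp add: \<W>_def)
      moreover have "y \<in> W" using T(2) W(2) v(2) by simp
      ultimately show "y \<in> \<Union>\<W>" by (rule UnionI)
    qed
  qed (simp add: \<W>_def)
  then obtain \<F> where F: "finite \<F>" "\<F> \<subseteq> \<W>" "?\<Phi> ` V \<subseteq> \<Union>\<F>" by (elim exE conjE)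
  show "\<exists>\<F>. finite \<F> \<and> \<F> \<subseteq> \<U> \<and> V \<subseteq> \<Union>\<F>"
  proof (intro exI conjI)
    show "finite ((\<lambda>W. ?\<Phi> -` W \<inter> V) ` \<F>)" using F(1) by simp
    show "(\<lambda>W. ?\<Phi> -` W \<inter> V) ` \<F> \<subseteq> \<U>" using F(2) by (auto simp: \<W>_def)
    show "V \<subseteq> \<Union> ((\<lambda>W. ?\<Phi> -` W \<inter> V) ` \<F>)" using F(3) by blast
  qed
qed

text \<open>Continuity of the vector operations can be tested after applying each functional, where
  linearity reduces it to addition and multiplication of reals. Preimages of symmetric intervals
  supply the convex neighbourhoods of 0.\<close>

lemma locally_convex_functional_topology:
  fixes V :: "'v::real_vector set"
  assumes V: "subspace V" and lin: "\<And>i. i \<in> I \<Longrightarrow> linear (L i)"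
    and sep: "\<And>v. v \<in> V \<Longrightarrow> (\<And>i. i \<in> I \<Longrightarrow> L i v = 0) \<Longrightarrow> v = 0"
  shows "locally_convex_space (functional_topology V I L)"
proof -
  let ?T = "functional_topology V I L"
  have "Hausdorff_space ?T"
  proof (rule Hausdorff_functional_topology)
    fix v w assume "v \<in> V" "w \<in> V" "\<And>i. i \<in> I \<Longrightarrow> L i v = L i w"
    then have "v - w = 0"
      by (intro sep) (auto simp: subspace_diff[OF V] linear_diff[OF lin])
    then show "v = w" by simp
  qed
  moreover have "continuous_map (prod_topology ?T ?T) ?T (\<lambda>(x, y). x + y)"
  proof (rule continuous_map_into_functional_topology)
    show "(\<lambda>(x, y). x + y) \<in> topspace (prod_topology ?T ?T) \<rightarrow> V"
      by (auto simp: subspace_add[OF V])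
    fix i assume i: "i \<in> I"
    have "continuous_map (prod_topology ?T ?T) euclideanreal (\<lambda>p. L i (fst p) + L i (snd p))"
      by (intro continuous_map_add
          continuous_map_compose[OF continuous_map_fst continuous_map_functional[OF i], unfolded o_def]
          continuous_map_compose[OF continuous_map_snd continuous_map_functional[OF i], unfolded o_def])
    then show "continuous_map (prod_topology ?T ?T) euclideanreal (\<lambda>p. L i (case p of (x, y) \<Rightarrow> x + y))"
      by (simp add: case_prod_beta linear_add[OF lin[OF i]])
  qed
  moreover have "continuous_map (prod_topology euclideanreal ?T) ?T (\<lambda>(c, x). c *\<^sub>R x)"
  proof (rule continuous_map_into_functional_topology)
    show "(\<lambda>(c, x). c *\<^sub>R x) \<in> topspace (prod_topology euclideanreal ?T) \<rightarrow> V"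
      by (auto simp: subspace_scale[OF V])
    fix i assume i: "i \<in> I"
    have "continuous_map (prod_topology euclideanreal ?T) euclideanreal (\<lambda>p. fst p * L i (snd p))"
      by (intro continuous_map_real_mult continuous_map_fst
          continuous_map_compose[OF continuous_map_snd continuous_map_functional[OF i], unfolded o_def])
    then show "continuous_map (prod_topology euclideanreal ?T) euclideanreal
        (\<lambda>p. L i (case p of (c, x) \<Rightarrow> c *\<^sub>R x))"
      by (simp add: case_prod_beta linear_scale[OF lin[OF i]])
  qed
  moreover have "\<exists>W. openin ?T W \<and> convex W \<and> 0 \<in> W \<and> W \<subseteq> U" if U: "openin ?T U" "0 \<in> U" for U
  proof -
    obtain F \<epsilon> where F: "finite F" "F \<subseteq> I" "0 < \<epsilon>" "{w \<in> V. \<forall>i\<in>F. \<bar>L i w - L i 0\<bar> < \<epsilon>} \<subseteq> U"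
      using functional_topology_nbhd[OF U] .
    let ?W = "{w \<in> V. \<forall>i\<in>F. L i w \<in> {-\<epsilon><..<\<epsilon>}}"
    have W: "?W = V \<inter> (\<Inter>i\<in>F. {w \<in> topspace ?T. L i w \<in> {-\<epsilon><..<\<epsilon>}})" by auto
    have "openin ?T ?W"
    proof (cases "F = {}")
      case True
      then show ?thesis using openin_topspace[of ?T] by simp
    next
      case False
      have "openin ?T {w \<in> topspace ?T. L i w \<in> {-\<epsilon><..<\<epsilon>}}" if "i \<in> F" for i
        using F(2) that by (intro openin_continuous_map_preimage[OF continuous_map_functional]) auto
      then have "openin ?T (\<Inter>i\<in>F. {w \<in> topspace ?T. L i w \<in> {-\<epsilon><..<\<epsilon>}})"
        using F(1) False by (intro openin_INT2) auto
      then show ?thesis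
        unfolding W using openin_topspace[of ?T] by (intro openin_Int) simp_all
    qed
    moreover have "convex ?W"
    proof -
      have "convex (L i -` {-\<epsilon><..<\<epsilon>})" if "i \<in> F" for i
        using F(2) that by (intro convex_linear_vimage lin) auto
      then have "convex (V \<inter> (\<Inter>i\<in>F. L i -` {-\<epsilon><..<\<epsilon>}))"
        by (intro convex_Int convex_INT subspace_imp_convex[OF V])
      moreover have "?W = V \<inter> (\<Inter>i\<in>F. L i -` {-\<epsilon><..<\<epsilon>})" by auto
      ultimately show ?thesis by simp
    qed
    moreover have L0: "L i 0 = 0" if "i \<in> F" for i
      using F(2) that by (intro linear_0 lin) auto
    then have "0 \<in> ?W" using F(3) subspace_0[OF V] by auto
    moreover have "?W \<subseteq> {w \<in> V. \<forall>i\<in>F. \<bar>L i w - L i 0\<bar> < \<epsilon>}" using L0 by (auto simp: abs_less_iff)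
    with F(4) have "?W \<subseteq> U" by (rule order_trans[rotated])
    ultimately show ?thesis by blast
  qed
  ultimately show ?thesis
    unfolding locally_convex_space_def using V by simp
qed

text \<open>The set is the linear span of \<open>S\<close>. Writing it as a difference of two cones
  matters later: an element is a combination of only two points of \<open>S\<close>, so its
  vanishing on all functionals becomes a comparison of two measures.\<close>

lemma subspace_convex_differences:
  fixes S :: "'v::real_vector set"
  assumes S: "convex S" "S \<noteq> {}"
  shows "subspace {a *\<^sub>R x - b *\<^sub>R y | a b x y. 0 \<le> a \<and> 0 \<le> b \<and> x \<in> S \<and> y \<in> S}" (is "subspace ?V")
proof (rule subspaceI)
  \<comment> \<open>Dividing by \<open>a + b\<close> turns the sum into a convex combination; when
    \<open>a + b\<close> is 0, any point of \<open>S\<close> will do.\<close>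
  have cone: "\<exists>z\<in>S. a *\<^sub>R x + b *\<^sub>R y = (a + b) *\<^sub>R z"
    if "0 \<le> a" "0 \<le> b" "x \<in> S" "y \<in> S" for a b x y
  proof (cases "a + b = 0")
    case True
    then have "a = 0" "b = 0" using that by linarith+
    then show ?thesis using that by auto
  next
    case False
    then have "a + b > 0" using that by linarith
    moreover have "(a / (a + b)) *\<^sub>R x + (b / (a + b)) *\<^sub>R y \<in> S"
      using that \<open>a + b > 0\<close>
      by (intro convexD[OF S(1)]) (auto simp: add_divide_distrib[symmetric])
    ultimately show ?thesis
      by (intro bexI[of _ "(a / (a + b)) *\<^sub>R x + (b / (a + b)) *\<^sub>R y"]) (auto simp: scaleR_add_right)
  qed
  obtain s where "s \<in> S" using S(2) by blast
  then show "0 \<in> ?V"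
    by (intro CollectI exI[of _ "0::real"] exI[of _ s]) auto
  show "v + w \<in> ?V" if vw: "v \<in> ?V" "w \<in> ?V" for v w
  proof -
    obtain a b x y where v: "v = a *\<^sub>R x - b *\<^sub>R y" "0 \<le> a" "0 \<le> b" "x \<in> S" "y \<in> S"
      using vw(1) by blast
    obtain a' b' x' y' where w: "w = a' *\<^sub>R x' - b' *\<^sub>R y'" "0 \<le> a'" "0 \<le> b'" "x' \<in> S" "y' \<in> S"
      using vw(2) by blast
    obtain p where p: "p \<in> S" "a *\<^sub>R x + a' *\<^sub>R x' = (a + a') *\<^sub>R p"
      using cone[of a a' x x'] v w by blast
    obtain q where q: "q \<in> S" "b *\<^sub>R y + b' *\<^sub>R y' = (b + b') *\<^sub>R q"
      using cone[of b b' y y'] v w by blast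
    have "v + w = (a *\<^sub>R x + a' *\<^sub>R x') - (b *\<^sub>R y + b' *\<^sub>R y')"
      by (simp add: v(1) w(1))
    also have "\<dots> = (a + a') *\<^sub>R p - (b + b') *\<^sub>R q"
      by (simp add: p(2) q(2))
    finally have "v + w = (a + a') *\<^sub>R p - (b + b') *\<^sub>R q" .
    moreover have "0 \<le> a + a'" "0 \<le> b + b'" using v w by simp_all
    ultimately show ?thesis using p(1) q(1) by blast
  qed
  show "c *\<^sub>R v \<in> ?V" if vc: "v \<in> ?V" for c v
  proof -
    obtain a b x y where v: "v = a *\<^sub>R x - b *\<^sub>R y" "0 \<le> a" "0 \<le> b" "x \<in> S" "y \<in> S"
      using vc by blast
    show ?thesis
    proof (cases "0 \<le> c")
      case True
      then have "c *\<^sub>R v = (c * a) *\<^sub>R x - (c * b) *\<^sub>R y" "0 \<le> c * a" "0 \<le> c * b"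
        using v by (simp_all add: scaleR_diff_right)
      then show ?thesis using v by blast
    next
      case False
      then have "c *\<^sub>R v = (- c * b) *\<^sub>R y - (- c * a) *\<^sub>R x" "0 \<le> - c * b" "0 \<le> - c * a"
        using v by (simp_all add: scaleR_diff_right mult_nonpos_nonneg)
      then show ?thesis using v by blast
    qed
  qed
qed

section \<open>The space of Radon probability measures\<close>

lemma topspace_prob_measures: "topspace (prob_measures X) = {measure M | M. M \<in> radon_prob X}"
proof
  show "topspace (prob_measures X) \<subseteq> {measure M | M. M \<in> radon_prob X}"
    by (auto simp: prob_measures_def)
  have "{measure M | M. M \<in> radon_prob X}
      = {measure M | M. M \<in> radon_prob X \<and> (LINT x|M. (\<lambda>_. 0) x) \<in> (UNIV :: real set)}" by simp
  then have "{measure M | M. M \<in> radon_prob X} \<in> {{measure M | M. M \<in> radon_prob X \<and>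
      (LINT x|M. f x) \<in> U} | f U. continuous_map X euclideanreal f \<and> open (U :: real set)}"
    by (intro CollectI exI[of _ "\<lambda>_. 0"] exI[of _ UNIV]) simp
  then show "{measure M | M. M \<in> radon_prob X} \<subseteq> topspace (prob_measures X)"
    unfolding prob_measures_def topology_generated_by_topspace by (rule Union_upper)
qed

lemma linear_apply: "linear (\<lambda>v :: 'b \<Rightarrow> real. v x)"
  by (rule linearI) (simp_all add: plus_fun_def scaleR_fun_def)

section \<open>The finitely additive probabilities as a compact subset of a cube\<close>

lemma closedin_Collect_all:
  assumes "\<And>i. i \<in> I \<Longrightarrow> closedin T {x \<in> topspace T. Q i x}"
  shows "closedin T {x \<in> topspace T. \<forall>i\<in>I. Q i x}"
proof (cases "I = {}")
  case False
  then have "{x \<in> topspace T. \<forall>i\<in>I. Q i x} = \<Inter> ((\<lambda>i. {x \<in> topspace T. Q i x}) ` I)" by auto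
  then show ?thesis using assms False by (auto intro!: closedin_Inter)
qed simp

lemma closedin_Collect_eq_real:
  assumes "continuous_map T euclideanreal f" "continuous_map T euclideanreal g"
  shows "closedin T {x \<in> topspace T. f x = g x}"
proof -
  have "closedin T {x \<in> topspace T. f x - g x \<in> {0}}"
    by (intro closedin_continuous_map_preimage[where Y = euclideanreal] continuous_map_diff assms) simp
  then show ?thesis by simp
qed

text \<open>Each defining condition involves at most three coordinates and is closed in
  them.\<close>

lemma closedin_prob_charge:
  "closedin (product_topology (\<lambda>_. euclideanreal) (Pow D))
     {g \<in> topspace (product_topology (\<lambda>_. euclideanreal) (Pow D)). prob_charge D g}"
    (is "closedin ?P _")
proof -
  have proj: "continuous_map ?P euclideanreal (\<lambda>g. g A)" if "A \<subseteq> D" for A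
    using that by (intro continuous_map_product_projection) simp
  have 1: "closedin ?P {g \<in> topspace ?P. \<forall>A\<in>Pow D. 0 \<le> g A}"
  proof (rule closedin_Collect_all)
    fix A assume "A \<in> Pow D"
    then show "closedin ?P {g \<in> topspace ?P. 0 \<le> g A}"
      using closedin_continuous_map_preimage[OF proj[of A], of "{0..}"] by simp
  qed
  have 2: "closedin ?P {g \<in> topspace ?P. g D = 1}"
    by (rule closedin_Collect_eq_real) (simp_all add: proj)
  \<comment> \<open>Disjoint pairs are bundled into a single index so that
    \<open>closedin_Collect_all\<close> applies once.\<close>
  have 3: "closedin ?P {g \<in> topspace ?P.
      \<forall>q\<in>{(A, B). A \<subseteq> D \<and> B \<subseteq> D \<and> A \<inter> B = {}}. g (fst q \<union> snd q) = g (fst q) + g (snd q)}"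
    by (intro closedin_Collect_all closedin_Collect_eq_real continuous_map_add proj) auto
  have eq: "{g \<in> topspace ?P. prob_charge D g} = {g \<in> topspace ?P. \<forall>A\<in>Pow D. 0 \<le> g A}
      \<inter> {g \<in> topspace ?P. g D = 1} \<inter> {g \<in> topspace ?P.
      \<forall>q\<in>{(A, B). A \<subseteq> D \<and> B \<subseteq> D \<and> A \<inter> B = {}}. g (fst q \<union> snd q) = g (fst q) + g (snd q)}"
    unfolding prob_charge_def by auto
  show ?thesis unfolding eq by (intro closedin_Int 1 2 3)
qed

lemma compactin_prob_charge:
  "compactin (product_topology (\<lambda>_. euclideanreal) (Pow D))
     {g \<in> topspace (product_topology (\<lambda>_. euclideanreal) (Pow D)). prob_charge D g}"
proof (rule closed_compactin[OF _ _ closedin_prob_charge])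
  show "compactin (product_topology (\<lambda>_. euclideanreal) (Pow D)) (\<Pi>\<^sub>E A\<in>Pow D. {0..1})"
    by (simp add: compactin_PiE)
  show "{g \<in> topspace (product_topology (\<lambda>_. euclideanreal) (Pow D)). prob_charge D g}
      \<subseteq> (\<Pi>\<^sub>E A\<in>Pow D. {0..1})"
  proof
    fix g assume "g \<in> {g \<in> topspace (product_topology (\<lambda>_. euclideanreal) (Pow D)). prob_charge D g}"
    then have "prob_charge D g" "g \<in> extensional (Pow D)" by (simp_all add: PiE_iff)
    then show "g \<in> (\<Pi>\<^sub>E A\<in>Pow D. {0..1})"
      by (simp add: PiE_iff prob_chargeD(1) prob_charge_le_1)
  qed
qed

section \<open>Clopen step functions and the weak topology\<close>

context discrete_beta
begin

text \<open>The closures of the finitely many fibres of \<phi> partition the space; in other words,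
  a function with finitely many values on \<open>D\<close> extends to \<open>X\<close>.\<close>

lemma clp_image_fibres:
  assumes "finite (\<phi> ` D)" "p \<in> topspace X"
  shows "\<exists>j\<in>\<phi> ` D. \<forall>i. p \<in> clp {d \<in> D. \<phi> d = i} \<longleftrightarrow> i = j"
proof -
  have "D = (\<Union>j\<in>\<phi> ` D. {d \<in> D. \<phi> d = j})" by auto
  then have "p \<in> clp (\<Union>j\<in>\<phi> ` D. {d \<in> D. \<phi> d = j})"
    using assms(2) clp_D by simp
  then obtain j where j: "j \<in> \<phi> ` D" "p \<in> clp {d \<in> D. \<phi> d = j}"
    unfolding clp_UN_finite[OF assms(1)] by blast
  have unique: "i = j" if "p \<in> clp {d \<in> D. \<phi> d = i}" for i
  proof (rule ccontr)
    assume "i \<noteq> j"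
    then have "clp {d \<in> D. \<phi> d = i} \<inter> clp {d \<in> D. \<phi> d = j} = {}"
      by (intro clp_disjoint) auto
    then show False using that j(2) by blast
  qed
  show ?thesis
  proof (intro bexI[OF _ j(1)] allI iffI)
    show "i = j" if "p \<in> clp {d \<in> D. \<phi> d = i}" for i using that by (rule unique)
    show "p \<in> clp {d \<in> D. \<phi> d = i}" if "i = j" for i unfolding that by (rule j(2))
  qed
qed

lemma continuous_bounded_clp:
  assumes f: "continuous_map X euclideanreal f" and A: "\<And>d. d \<in> A \<Longrightarrow> f (e d) \<in> {a..b}" "A \<subseteq> D"
    and p: "p \<in> clp A"
  shows "f p \<in> {a..b}"
proof -
  have "closedin X {p \<in> topspace X. f p \<in> {a..b}}"
    by (rule closedin_continuous_map_preimage[OF f]) simp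
  moreover have "e ` A \<subseteq> {p \<in> topspace X. f p \<in> {a..b}}"
    using A embed by auto
  ultimately show ?thesis
    using p closure_of_minimal unfolding clp_def by blast
qed

lemma continuous_bounded:
  assumes "continuous_map X euclideanreal f"
  obtains B where "\<And>p. p \<in> topspace X \<Longrightarrow> \<bar>f p\<bar> \<le> B"
proof -
  have "compactin euclideanreal (f ` topspace X)"
    using image_compactin[OF _ assms] compact by (simp add: compact_space_def)
  then have "bounded (f ` topspace X)" by (simp add: compact_imp_bounded)
  then obtain B where "\<forall>y\<in>f ` topspace X. \<bar>y\<bar> \<le> B" unfolding bounded_real by blast
  then show ?thesis using that[of B] by simp
qed

text \<open>Round the values on \<open>D\<close> down to multiples of \<epsilon>. By boundedness
  only finitely many multiples occur, and on the closure of each fibre the function keeps to the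
  same interval.\<close>

lemma step_approximation:
  assumes f: "continuous_map X euclideanreal f" and "0 < \<epsilon>"
  obtains J :: "int set" and c A where "finite J" "\<And>j. A j \<subseteq> D"
    "\<And>p. p \<in> topspace X \<Longrightarrow> \<bar>f p - (\<Sum>j\<in>J. c j * indicator (clp (A j)) p)\<bar> \<le> \<epsilon>"
proof -
  define \<phi> where "\<phi> d = \<lfloor>f (e d) / \<epsilon>\<rfloor>" for d
  define c where "c j = \<epsilon> * of_int j" for j
  define A where "A j = {d \<in> D. \<phi> d = j}" for j
  obtain B where B: "\<And>p. p \<in> topspace X \<Longrightarrow> \<bar>f p\<bar> \<le> B"
    using continuous_bounded[OF f] by blast
  have "\<phi> ` D \<subseteq> {\<lfloor>- B / \<epsilon>\<rfloor>..\<lfloor>B / \<epsilon>\<rfloor>}"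
  proof
    fix j assume "j \<in> \<phi> ` D"
    then obtain d where d: "d \<in> D" "j = \<phi> d" by blast
    have "\<bar>f (e d)\<bar> \<le> B" using B embed d(1) by auto
    then have "- B / \<epsilon> \<le> f (e d) / \<epsilon>" "f (e d) / \<epsilon> \<le> B / \<epsilon>"
      using \<open>0 < \<epsilon>\<close> by (intro divide_right_mono; linarith)+
    then show "j \<in> {\<lfloor>- B / \<epsilon>\<rfloor>..\<lfloor>B / \<epsilon>\<rfloor>}"
      unfolding d(2) \<phi>_def atLeastAtMost_iff by (intro conjI floor_mono)
  qed
  then have fin: "finite (\<phi> ` D)" by (rule finite_subset) simp
  have "\<bar>f p - (\<Sum>j\<in>\<phi> ` D. c j * indicator (clp (A j)) p)\<bar> \<le> \<epsilon>" if p: "p \<in> topspace X" for p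
  proof -
    obtain j where j: "j \<in> \<phi> ` D" "\<And>i. p \<in> clp (A i) \<longleftrightarrow> i = j"
      using clp_image_fibres[OF fin p] unfolding A_def by blast
    have jp: "p \<in> clp (A j)" using j(2)[of j] by simp
    have "(\<Sum>i\<in>\<phi> ` D. c i * indicator (clp (A i)) p) = (\<Sum>i\<in>\<phi> ` D. if i = j then c j else 0)"
      by (rule sum.cong) (auto simp: j(2) indicator_def)
    also have "\<dots> = c j" using fin j(1) by simp
    finally have s: "(\<Sum>i\<in>\<phi> ` D. c i * indicator (clp (A i)) p) = c j" .
    \<comment> \<open>Rounding gives a half-open interval on \<open>D\<close>; it is closed up here
      because only closed bounds pass to the closure of a fibre.\<close>
    have "f p \<in> {c j..c j + \<epsilon>}"
    proof (rule continuous_bounded_clp[OF f _ _ jp])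
      fix d assume "d \<in> A j"
      then have "j = \<lfloor>f (e d) / \<epsilon>\<rfloor>" by (simp add: A_def \<phi>_def)
      then have "of_int j \<le> f (e d) / \<epsilon>" "f (e d) / \<epsilon> \<le> of_int j + 1" by linarith+
      then show "f (e d) \<in> {c j..c j + \<epsilon>}"
        using \<open>0 < \<epsilon>\<close> by (simp add: c_def field_simps)
    qed (simp add: A_def)
    then show ?thesis unfolding s by auto
  qed
  moreover have "A j \<subseteq> D" for j by (auto simp: A_def)
  ultimately show ?thesis using that[of "\<phi> ` D" A c] fin by blast
qed

lemma integrable_continuous:
  assumes "M \<in> radon_prob X" and f: "continuous_map X euclideanreal f"
  shows "integrable M f"
proof -
  interpret prob_space M using assms(1) by (rule radon_probD)
  obtain B where B: "\<And>p. p \<in> topspace X \<Longrightarrow> \<bar>f p\<bar> \<le> B"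
    using continuous_bounded[OF f] by blast
  have "f \<in> borel_measurable M"
    using continuous_map_borel_measurable[OF f] measurable_cong_sets[OF radon_probD(3)[OF assms(1)] refl]
    by blast
  then show ?thesis
    using B by (intro integrable_const_bound[of _ B] AE_I2) (simp_all add: radon_probD(2)[OF assms(1)])
qed

lemma integral_step_approximation:
  assumes M: "M \<in> radon_prob X" and f: "continuous_map X euclideanreal f" and A: "finite J"
    and bound: "\<And>p. p \<in> topspace X \<Longrightarrow> \<bar>f p - (\<Sum>j\<in>J. c j * indicator (clp (A j)) p)\<bar> \<le> \<epsilon>"
  shows "\<bar>(LINT x|M. f x) - (\<Sum>j\<in>J. c j * measure M (clp (A j)))\<bar> \<le> \<epsilon>"
proof -
  interpret prob_space M using M by (rule radon_probD)
  let ?g = "\<lambda>p. \<Sum>j\<in>J. c j * indicator (clp (A j)) p"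
  have sM: "space M = topspace X" by (rule radon_probD[OF M])
  have int: "integrable M (indicator (clp (A j)) :: _ \<Rightarrow> real)" for j
    using clp_sets[OF M] by (intro integrable_real_indicator) (auto simp: emeasure_eq_measure)
  have g: "integrable M ?g" by (intro Bochner_Integration.integrable_sum integrable_mult_right int)
  have Lg: "(LINT x|M. ?g x) = (\<Sum>j\<in>J. c j * measure M (clp (A j)))"
    using int clp_subset by (simp add: Bochner_Integration.integral_sum sM Int_absorb2)
  have fi: "integrable M f" by (rule integrable_continuous[OF M f])
  have d: "integrable M (\<lambda>p. f p - ?g p)" by (intro Bochner_Integration.integrable_diff fi g)
  have "(LINT x|M. f x - ?g x) \<le> \<epsilon>"
  proof (intro integral_le_const d AE_I2)
    fix x assume "x \<in> space M" then show "f x - ?g x \<le> \<epsilon>" using bound[of x] sM by auto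
  qed
  moreover have "- \<epsilon> \<le> (LINT x|M. f x - ?g x)"
  proof (intro integral_ge_const d AE_I2)
    fix x assume "x \<in> space M" then show "- \<epsilon> \<le> f x - ?g x" using bound[of x] sM by auto
  qed
  moreover have "(LINT x|M. f x - ?g x) = (LINT x|M. f x) - (\<Sum>j\<in>J. c j * measure M (clp (A j)))"
    using Bochner_Integration.integral_diff[OF fi g] Lg by simp
  ultimately show ?thesis by auto
qed

lemma continuous_indicator_clp:
  assumes "A \<subseteq> D" shows "continuous_map X euclideanreal (indicator (clp A))"
proof -
  have "openin X {x \<in> topspace X. indicator (clp A) x \<in> U}" for U :: "real set"
  proof -
    have "{x \<in> topspace X. indicator (clp A) x \<in> U}
        = (if 1 \<in> U then clp A else {}) \<union> (if 0 \<in> U then clp (D - A) else {})"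
      using clp_subset[of A] clp_compl[OF assms] by (auto simp: indicator_def split: if_splits)
    moreover have "openin X \<dots>"
      using assms by (intro openin_Un) (simp_all add: clp_open)
    ultimately show ?thesis by simp
  qed
  then show ?thesis by (simp add: continuous_map_def)
qed

text \<open>The step functions are uniformly dense in the continuous functions, so the weak topology is
  already generated by the evaluations at the clopen sets.\<close>

lemma prob_measures_eq:
  "prob_measures X
     = functional_topology {measure M | M. M \<in> radon_prob X} (Pow D) (\<lambda>A v. v (clp A))"
    (is "_ = functional_topology ?S _ ?L")
  unfolding topology_eq
proof (intro allI iffI)
  let ?F = "functional_topology ?S (Pow D) ?L"
  fix U assume "openin (prob_measures X) U"
  then show "openin ?F U"
    unfolding prob_measures_def openin_topology_generated_by_iff
  proof (induction rule: generate_topology_on.induct)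
    case (Basis s)
    then obtain f V where s: "s = {measure M | M. M \<in> radon_prob X \<and> (LINT x|M. f x) \<in> V}"
      "continuous_map X euclideanreal f" "open (V :: real set)" by auto
    show ?case
    proof (subst openin_subopen, intro ballI)
      fix v assume "v \<in> s"
      then obtain M where M: "v = measure M" "M \<in> radon_prob X" "(LINT x|M. f x) \<in> V"
        using s(1) by blast
      obtain \<epsilon> where \<epsilon>: "0 < \<epsilon>" "ball (LINT x|M. f x) \<epsilon> \<subseteq> V"
        using s(3) M(3) open_contains_ball by blast
      \<comment> \<open>One third each for replacing the integral by the step sum under
        \<open>M\<close>, the same under \<open>N\<close>, and the distance between the two step
        sums.\<close>
      then have "0 < \<epsilon> / 3" by simp
      from step_approximation[OF s(2) this] obtain J :: "int set" and c A where J: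
        "finite J" "\<And>j. A j \<subseteq> D"
        "\<And>p. p \<in> topspace X \<Longrightarrow> \<bar>f p - (\<Sum>j\<in>J. c j * indicator (clp (A j)) p)\<bar> \<le> \<epsilon> / 3"
        by metis
      define g where "g w = (\<Sum>j\<in>J. c j * w (clp (A j)))" for w :: "'b set \<Rightarrow> real"
      have near: "\<bar>(LINT x|N. f x) - g (measure N)\<bar> \<le> \<epsilon> / 3" if "N \<in> radon_prob X" for N
        unfolding g_def by (rule integral_step_approximation[OF that s(2) J(1,3)])
      have "continuous_map ?F euclideanreal g"
        unfolding g_def using J(2)
        by (intro continuous_map_sum J(1) continuous_map_real_mult_left
            continuous_map_functional[where L = ?L]) simp
      then have "openin ?F {w \<in> topspace ?F. g w \<in> ball (g v) (\<epsilon> / 3)}"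
        by (rule openin_continuous_map_preimage) simp
      moreover have "v \<in> {w \<in> topspace ?F. g w \<in> ball (g v) (\<epsilon> / 3)}"
        using M \<epsilon>(1) by auto
      moreover have "{w \<in> topspace ?F. g w \<in> ball (g v) (\<epsilon> / 3)} \<subseteq> s"
      proof
        fix w assume "w \<in> {w \<in> topspace ?F. g w \<in> ball (g v) (\<epsilon> / 3)}"
        then obtain N where N: "w = measure N" "N \<in> radon_prob X" "dist (g v) (g w) < \<epsilon> / 3"
          by auto
        have "(LINT x|N. f x) \<in> ball (LINT x|M. f x) \<epsilon>"
          using near[OF M(2)] near[OF N(2)] N(3) unfolding M(1) N(1) mem_ball dist_real_def
          by linarith
        then show "w \<in> s" using \<epsilon>(2) N s(1) by blast
      qed
      ultimately show "\<exists>T. openin ?F T \<and> v \<in> T \<and> T \<subseteq> s" by blast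
    qed
  qed auto
next
  let ?F = "functional_topology ?S (Pow D) ?L"
  fix U assume U: "openin ?F U"
  have "continuous_map (prob_measures X) ?F id"
  proof (rule continuous_map_into_functional_topology)
    show "id \<in> topspace (prob_measures X) \<rightarrow> ?S" by (simp add: topspace_prob_measures)
    fix A assume "A \<in> Pow D"
    then have A: "A \<subseteq> D" by simp
    have "openin (prob_measures X) {v \<in> topspace (prob_measures X). v (clp A) \<in> V}"
      if "open V" for V :: "real set"
    proof -
      have "measure M (clp A) = (LINT x|M. indicator (clp A) x)" if "M \<in> radon_prob X" for M
        using clp_subset[of A] by (simp add: radon_probD(2)[OF that] Int_absorb2)
      then have eq: "{v \<in> topspace (prob_measures X). v (clp A) \<in> V}
          = {measure M | M. M \<in> radon_prob X \<and> (LINT x|M. indicator (clp A) x) \<in> V}"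
        unfolding topspace_prob_measures by auto
      show ?thesis
        unfolding eq unfolding prob_measures_def
        by (intro topology_generated_by_Basis CollectI exI[of _ "indicator (clp A)"] exI[of _ V]
            conjI refl continuous_indicator_clp A that)
    qed
    then show "continuous_map (prob_measures X) euclideanreal (\<lambda>v. ?L A (id v))"
      by (simp add: continuous_map_def)
  qed
  from openin_continuous_map_preimage[OF this U]
  have "openin (prob_measures X) {v \<in> topspace (prob_measures X). v \<in> U}" by simp
  moreover have "U \<subseteq> topspace (prob_measures X)"
    using openin_subset[OF U] by (simp add: topspace_prob_measures)
  ultimately show "openin (prob_measures X) U" by (simp add: Collect_conj_eq Int_absorb1)
qed

text \<open>The correspondence of measures and charges in topological form:
  \<open>prob_charge_radon\<close> gives one inclusion and \<open>radon_extension\<close> the other.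
  Compactness of \<open>K\<close> then comes from the cube.\<close>

lemma radon_charges:
  "(\<lambda>v. \<lambda>A\<in>Pow D. v (clp A)) ` {measure M | M. M \<in> radon_prob X}
     = {g \<in> topspace (product_topology (\<lambda>_. euclideanreal) (Pow D)). prob_charge D g}"
    (is "?\<Phi> ` ?S = ?C")
proof
  have "prob_charge D (?\<Phi> (measure M))" if "M \<in> radon_prob X" for M
    using prob_charge_radon[OF that] unfolding prob_charge_def by auto
  then show "?\<Phi> ` ?S \<subseteq> ?C" by (fastforce simp: PiE_iff)
  show "?C \<subseteq> ?\<Phi> ` ?S"
  proof
    fix g assume g: "g \<in> ?C"
    then obtain M where M: "M \<in> radon_prob X" "\<forall>A\<subseteq>D. measure M (clp A) = g A"
      using radon_extension[of g] by auto
    have "?\<Phi> (measure M) = g"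
      using M g by (intro extensionalityI[of _ "Pow D"]) (auto simp: PiE_iff)
    then show "g \<in> ?\<Phi> ` ?S" using M(1) by blast
  qed
qed

section \<open>\<open>K\<close> as a convex compactum containing the Dirac measures\<close>

lemma compact_prob_measures: "compact_space (prob_measures X)"
proof -
  have "compactin (product_topology (\<lambda>_. euclideanreal) (Pow D))
      ((\<lambda>v. \<lambda>A\<in>Pow D. v (clp A)) ` {measure M | M. M \<in> radon_prob X})"
    unfolding radon_charges by (rule compactin_prob_charge)
  then show ?thesis
    unfolding prob_measures_eq by (rule compact_functional_topology)
qed

lemma radon_functions_eqI:
  assumes "v \<in> {measure M | M. M \<in> radon_prob X}" "w \<in> {measure M | M. M \<in> radon_prob X}"
    and "\<And>A. A \<in> Pow D \<Longrightarrow> v (clp A) = w (clp A)"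
  shows "v = w"
proof -
  obtain M N where MN: "v = measure M" "M \<in> radon_prob X" "w = measure N" "N \<in> radon_prob X"
    using assms(1,2) by auto
  have "M = N"
    by (rule radon_prob_eqI[OF MN(2,4)]) (use assms(3) MN in auto)
  then show ?thesis using MN by simp
qed

lemma Hausdorff_prob_measures: "Hausdorff_space (prob_measures X)"
  unfolding prob_measures_eq by (rule Hausdorff_functional_topology) (rule radon_functions_eqI)

lemma dirac_in_prob_measures:
  "x \<in> topspace X \<Longrightarrow> dirac X x \<in> topspace (prob_measures X)"
  using dirac_radon[OF Hausdorff] by (auto simp: topspace_prob_measures dirac_def)

lemma dirac_clp:
  assumes "x \<in> topspace X" shows "dirac X x (clp A) = indicator (clp A) x"
  unfolding dirac_def using assms
  by (intro measure_return) (simp_all add: space_borel_measure closed_in_borel_measure clp_closed)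

lemma convex_radon: "convex {measure M | M. M \<in> radon_prob X}"
proof (rule convexI)
  fix v w :: "'b set \<Rightarrow> real" and s t :: real
  assume "v \<in> {measure M | M. M \<in> radon_prob X}" "w \<in> {measure M | M. M \<in> radon_prob X}"
    "0 \<le> s" "0 \<le> t" "s + t = 1"
  then obtain M N where *: "v = measure M" "M \<in> radon_prob X" "w = measure N" "N \<in> radon_prob X"
    by auto
  obtain R where "R \<in> radon_prob X" "measure R = (\<lambda>A. s * measure M A + t * measure N A)"
    using radon_prob_convex[OF Hausdorff *(2,4) \<open>0 \<le> s\<close> \<open>0 \<le> t\<close> \<open>s + t = 1\<close>] by blast
  moreover have "s *\<^sub>R v + t *\<^sub>R w = (\<lambda>A. s * measure M A + t * measure N A)"
    by (simp add: * scaleR_fun_def plus_fun_def)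
  ultimately show "s *\<^sub>R v + t *\<^sub>R w \<in> {measure M | M. M \<in> radon_prob X}" by force
qed

text \<open>The point to check is that evaluations at clopen sets separate the span. If they all
  vanish on \<open>a *\<^sub>R measure M - b *\<^sub>R measure N\<close>, the value at
  \<open>clp D\<close> gives \<open>a = b\<close>, since both measures have mass 1; unless this
  number is 0, \<open>radon_prob_eqI\<close> gives \<open>M = N\<close>.\<close>

lemma convex_compactum_prob_measures:
  assumes "D \<noteq> {}"
  shows "convex_compactum (prob_measures X)"
proof -
  let ?S = "{measure M | M. M \<in> radon_prob X}" and ?L = "\<lambda>A (v :: 'b set \<Rightarrow> real). v (clp A)"
  let ?V = "{a *\<^sub>R x - b *\<^sub>R y | a b x y. 0 \<le> a \<and> 0 \<le> b \<and> x \<in> ?S \<and> y \<in> ?S}"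
  have ne: "?S \<noteq> {}"
    using dirac_in_prob_measures embed assms unfolding topspace_prob_measures by blast
  have "?S \<subseteq> ?V"
  proof
    fix v assume "v \<in> ?S"
    moreover have "v = 1 *\<^sub>R v - 0 *\<^sub>R v" by simp
    ultimately show "v \<in> ?V" using zero_le_one order_refl by blast
  qed
  then have sub: "subtopology (functional_topology ?V (Pow D) ?L) ?S = prob_measures X"
    by (simp add: subtopology_functional_topology prob_measures_eq)
  have lc: "locally_convex_space (functional_topology ?V (Pow D) ?L)"
  proof (rule locally_convex_functional_topology)
    show "subspace ?V" by (rule subspace_convex_differences[OF convex_radon ne])
    show "linear (?L A)" for A by (rule linear_apply)
    fix v assume v: "v \<in> ?V" "\<And>A. A \<in> Pow D \<Longrightarrow> v (clp A) = 0"
    then obtain a b M N where *: "v = a *\<^sub>R measure M - b *\<^sub>R measure N"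
      "M \<in> radon_prob X" "N \<in> radon_prob X" by blast
    have v0: "a * measure M (clp A) = b * measure N (clp A)" if "A \<subseteq> D" for A
      using v(2)[of A] that by (simp add: *(1) scaleR_fun_def fun_diff_def)
    have "a = b"
      using v0[of D] prob_charge_radon[OF *(2)] prob_charge_radon[OF *(3)]
      by (simp add: prob_charge_def)
    show "v = 0"
    proof (cases "a = 0")
      case False
      then have "M = N"
        using v0 \<open>a = b\<close> by (intro radon_prob_eqI *) auto
      then show ?thesis using \<open>a = b\<close> by (simp add: *(1))
    qed (use * \<open>a = b\<close> in simp)
  qed
  have co: "compactin (functional_topology ?V (Pow D) ?L) ?S"
    unfolding compactin_subspace sub topspace_functional_topology
    by (intro conjI compact_prob_measures \<open>?S \<subseteq> ?V\<close>)
  show ?thesis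
    unfolding convex_compactum_def
    by (intro exI[of _ "functional_topology ?V (Pow D) ?L"] exI[of _ ?S] conjI
        lc co convex_radon sub[symmetric])
qed

text \<open>A continuous injection of a compact space into a Hausdorff space is an embedding. By
  \<open>prob_measures_eq\<close>, continuity needs testing only at clopen sets, where a Dirac
  measure returns the value of a continuous indicator.\<close>

lemma embedding_map_dirac: "embedding_map X (prob_measures X) (dirac X)"
proof (rule continuous_imp_embedding_map)
  show "continuous_map X (prob_measures X) (dirac X)"
    unfolding prob_measures_eq
  proof (rule continuous_map_into_functional_topology)
    show "dirac X \<in> topspace X \<rightarrow> {measure M | M. M \<in> radon_prob X}"
      using dirac_in_prob_measures by (auto simp: topspace_prob_measures)
    fix A assume "A \<in> Pow D"
    then have "continuous_map X euclideanreal (indicator (clp A))"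
      by (intro continuous_indicator_clp) simp
    then show "continuous_map X euclideanreal (\<lambda>x. dirac X x (clp A))"
      by (rule continuous_map_eq) (simp add: dirac_clp)
  qed
  show "inj_on (dirac X) (topspace X)"
  proof (rule inj_onI)
    fix x y assume *: "x \<in> topspace X" "y \<in> topspace X" "dirac X x = dirac X y"
    have "{x} \<in> sets (borel_measure X)"
      using * compactin_in_borel_measure[OF Hausdorff, of "{x}"] by simp
    then have "measure (return (borel_measure X) y) {x} = indicator {x} y"
      "measure (return (borel_measure X) x) {x} = indicator {x} x"
      using *(1,2) by (simp_all only: measure_return space_borel_measure)
    then show "x = y" using *(3) by (auto simp: dirac_def indicator_def split: if_splits)
  qed
qed (simp_all add: compact Hausdorff_prob_measures)

end

section \<open>The boundary\<close>

lemma prob_charge_UN: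
  assumes m: "prob_charge D m" and "finite I" "\<And>i. i \<in> I \<Longrightarrow> A i \<subseteq> D" "disjoint_family_on A I"
  shows "m (\<Union>i\<in>I. A i) = (\<Sum>i\<in>I. m (A i))"
  using assms(2-)
proof (induction I rule: finite_induct)
  case empty
  then show ?case using prob_chargeD(3)[OF m, of "{}" "{}"] by simp
next
  case (insert i I)
  have "m (A i \<union> (\<Union>i\<in>I. A i)) = m (A i) + m (\<Union>i\<in>I. A i)"
    using insert.hyps insert.prems
    by (intro prob_chargeD(3)[OF m]) (auto simp: disjoint_family_on_def)
  moreover have "m (\<Union>i\<in>I. A i) = (\<Sum>i\<in>I. m (A i))"
    using insert.prems by (intro insert.IH) (auto simp: disjoint_family_on_def)
  ultimately show ?case using insert.hyps by simp
qed

context discrete_beta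
begin

text \<open>For the concrete compactification this is \<open>D_omega\<close>, see
  \<open>countable_part_stone_cech\<close>.\<close>

definition countable_part :: "'b set" where
  "countable_part = \<Union> (clp ` {A. A \<subseteq> D \<and> countable A})"

lemma countable_part_subset: "countable_part \<subseteq> topspace X"
  using clp_subset by (auto simp: countable_part_def)

text \<open>The closures of the tails are nested, nonempty and closed, so compactness gives a common
  point; it lies in the closure of the countable range. Every diagonal argument below ends in this
  lemma.\<close>

lemma sequence_cluster_point:
  fixes x :: "nat \<Rightarrow> 'a"
  assumes "range x \<subseteq> D"
  obtains p where "p \<in> countable_part" "\<And>n. p \<in> clp (x ` {n..})"
proof -
  have "(\<Inter>n. clp (x ` {n..})) \<noteq> {}"
  proof (rule compact_space_imp_nest[OF compact])
    show "clp (x ` {n..}) \<noteq> {}" for n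
      using assms by (intro clp_nonempty) auto
    show "decseq (\<lambda>n. clp (x ` {n..}))"
      by (intro decseq_SucI clp_mono image_mono) auto
  qed (rule clp_closed)
  then obtain p where p: "\<And>n. p \<in> clp (x ` {n..})" by blast
  have "range x \<in> {A. A \<subseteq> D \<and> countable A}" using assms by simp
  moreover have "p \<in> clp (range x)" using p[of 0] by (simp add: atLeast_0)
  ultimately have "p \<in> countable_part" unfolding countable_part_def by (rule UN_I)
  then show ?thesis using p that by blast
qed

lemma countable_part_attains_max:
  assumes g: "continuous_map X euclideanreal g" and "D \<noteq> {}"
  obtains b where "b \<in> countable_part" "\<And>d. d \<in> D \<Longrightarrow> g (e d) \<le> g b"
proof -
  obtain B where B: "\<And>p. p \<in> topspace X \<Longrightarrow> \<bar>g p\<bar> \<le> B"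
    using continuous_bounded[OF g] by blast
  define m where "m = (SUP d\<in>D. g (e d))"
  have bdd: "bdd_above ((\<lambda>d. g (e d)) ` D)"
  proof (rule bdd_aboveI2)
    fix d assume "d \<in> D" then show "g (e d) \<le> B" using B[of "e d"] embed by auto
  qed
  have upper: "g (e d) \<le> m" if "d \<in> D" for d
    unfolding m_def using that bdd by (rule cSUP_upper)
  have "\<exists>d\<in>D. m - 1 / Suc n < g (e d)" for n
  proof -
    have "m - 1 / Suc n < m" by simp
    then show ?thesis unfolding m_def using less_cSUP_iff[OF assms(2) bdd] by blast
  qed
  then obtain x where x: "\<And>n. x n \<in> D" "\<And>n. m - 1 / Suc n < g (e (x n))" by metis
  then have "range x \<subseteq> D" by blast
  from sequence_cluster_point[OF this] obtain p where
    p: "p \<in> countable_part" "\<And>n. p \<in> clp (x ` {n..})" by blast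
  \<comment> \<open>The values along the tail from \<open>n\<close> on stay in a closed interval, so
    the value at the cluster point does too.\<close>
  have lower: "m - 1 / Suc n \<le> g p" for n
  proof -
    have "g p \<in> {m - 1 / Suc n..m}"
    proof (rule continuous_bounded_clp[OF g _ _ p(2)[of n]])
      fix d assume "d \<in> x ` {n..}"
      then obtain k where k: "d = x k" "n \<le> k" by auto
      have "1 / real (Suc k) \<le> 1 / real (Suc n)" using k(2) by (intro divide_left_mono) auto
      then show "g (e d) \<in> {m - 1 / Suc n..m}"
        using x[of k] upper[of d] k(1) by auto
    qed (use x(1) in auto)
    then show ?thesis by simp
  qed
  have "m \<le> g p"
  proof (rule ccontr)
    assume "\<not> m \<le> g p"
    then obtain n where "1 / real (Suc n) < m - g p"
      using nat_approx_posE[of "m - g p"] by auto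
    then show False using lower[of n] by linarith
  qed
  then show ?thesis using that[OF p(1)] upper by force
qed

text \<open>A basic neighbourhood constrains the values at finitely many subsets of \<open>D\<close>
  only. These cut \<open>D\<close> into finitely many atoms, and concentrating the mass of each atom
  at one of its points changes none of the constrained values. An index in \<open>J\<close> names an
  atom by the collection of constrained sets that contain it, whence the type of
  \<open>J\<close>.\<close>

lemma dirac_combinations_dense:
  assumes U: "openin (prob_measures X) U" and v: "v \<in> U"
  obtains J :: "'a set set set" and a d where "finite J" "\<And>j. j \<in> J \<Longrightarrow> 0 \<le> a j" "(\<Sum>j\<in>J. a j) = (1::real)"
    "\<And>j. j \<in> J \<Longrightarrow> d j \<in> D" "(\<Sum>j\<in>J. a j *\<^sub>R dirac X (e (d j))) \<in> U"
proof -
  let ?S = "{measure M | M. M \<in> radon_prob X}"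
  have "v \<in> ?S" using openin_subset[OF U] v by (auto simp: topspace_prob_measures)
  then obtain M where M: "v = measure M" "M \<in> radon_prob X" by blast
  obtain F \<epsilon> where F: "finite F" "F \<subseteq> Pow D" "0 < \<epsilon>"
      "{w \<in> ?S. \<forall>A\<in>F. \<bar>w (clp A) - v (clp A)\<bar> < \<epsilon>} \<subseteq> U"
    using functional_topology_nbhd[OF U[unfolded prob_measures_eq] v] by blast
  define \<phi> where "\<phi> d = {A \<in> F. d \<in> A}" for d
  define J where "J = \<phi> ` D"
  define d where "d j = (SOME c. c \<in> D \<and> \<phi> c = j)" for j
  define a where "a j = v (clp {c \<in> D. \<phi> c = j})" for j
  define w where "w = (\<Sum>j\<in>J. a j *\<^sub>R dirac X (e (d j)))"
  have "J \<subseteq> Pow F" by (auto simp: J_def \<phi>_def)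
  then have fin: "finite J" using F(1) finite_subset by blast
  have d: "d j \<in> D \<and> \<phi> (d j) = j" if "j \<in> J" for j
  proof -
    have "\<exists>c. c \<in> D \<and> \<phi> c = j" using that by (auto simp: J_def)
    then show ?thesis unfolding d_def by (rule someI_ex)
  qed
  have sum: "v (clp (\<Union>j\<in>I. {c \<in> D. \<phi> c = j})) = (\<Sum>j\<in>I. a j)" if "I \<subseteq> J" for I
    unfolding a_def M(1)
    by (rule prob_charge_UN[OF prob_charge_radon[OF M(2)]])
      (use finite_subset[OF that fin] in \<open>auto simp: disjoint_family_on_def\<close>)
  have pos: "0 \<le> a j" for j by (simp add: a_def M(1))
  have "(\<Union>j\<in>J. {c \<in> D. \<phi> c = j}) = D" by (auto simp: J_def)
  then have one: "(\<Sum>j\<in>J. a j) = 1"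
    using sum[of J] prob_chargeD(2)[OF prob_charge_radon[OF M(2)]] by (simp add: M(1))
  have "w \<in> ?S"
    unfolding w_def
  proof (rule convex_sum[OF fin convex_radon one pos])
    fix j assume "j \<in> J"
    then have "e (d j) \<in> topspace X" using d embed by auto
    then show "dirac X (e (d j)) \<in> ?S"
      using dirac_in_prob_measures by (simp add: topspace_prob_measures)
  qed
  moreover have "w (clp A) = v (clp A)" if A: "A \<in> F" for A
  proof -
    have AD: "A \<subseteq> D" using A F(2) by blast
    have "w (clp A) = (\<Sum>j\<in>J. a j * dirac X (e (d j)) (clp A))"
      unfolding w_def linear_sum[OF linear_apply] by (simp add: scaleR_fun_def)
    also have "\<dots> = (\<Sum>j\<in>J. if A \<in> j then a j else 0)"
    proof (rule sum.cong[OF refl])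
      fix j assume "j \<in> J"
      then have j: "d j \<in> D" "\<phi> (d j) = j" using d by auto
      have "e (d j) \<in> topspace X" using j(1) embed by auto
      moreover have "e (d j) \<in> clp A \<longleftrightarrow> A \<in> j"
        using clp_point_iff[OF j(1) AD] j(2) A by (auto simp: \<phi>_def)
      ultimately show "a j * dirac X (e (d j)) (clp A) = (if A \<in> j then a j else 0)"
        by (simp add: dirac_clp indicator_def)
    qed
    also have "\<dots> = (\<Sum>j\<in>{j \<in> J. A \<in> j}. a j)"
      using fin by (simp add: sum.inter_filter)
    also have "\<dots> = v (clp (\<Union>j\<in>{j \<in> J. A \<in> j}. {c \<in> D. \<phi> c = j}))"
      by (rule sum[symmetric]) auto
    also have "(\<Union>j\<in>{j \<in> J. A \<in> j}. {c \<in> D. \<phi> c = j}) = A"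
      using AD A by (auto simp: J_def \<phi>_def)
    finally show ?thesis .
  qed
  ultimately have "w \<in> U" using F(3,4) by auto
  then show ?thesis
    using that[of J a d] fin pos one d by (simp add: w_def)
qed

text \<open>If \<open>f\<close> exceeded \<open>m\<close> somewhere, the open set where it does
  would contain a convex combination of Dirac measures at points of \<open>D\<close>; but the set
  where \<open>f\<close> is at most \<open>m\<close> is convex and contains all of these Dirac
  measures.\<close>

lemma affine_le:
  assumes f: "f \<in> affine_functions (prob_measures X)"
    and m: "\<And>d. d \<in> D \<Longrightarrow> f (dirac X (e d)) \<le> m" and v: "v \<in> topspace (prob_measures X)"
  shows "f v \<le> m"
proof (rule ccontr)
  let ?K = "prob_measures X"
  assume "\<not> f v \<le> m"
  have cont: "continuous_map ?K euclideanreal f"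
    and affine: "\<And>x y t. x \<in> topspace ?K \<Longrightarrow> y \<in> topspace ?K \<Longrightarrow> t \<in> {0..1} \<Longrightarrow>
      f ((1 - t) *\<^sub>R x + t *\<^sub>R y) = (1 - t) * f x + t * f y"
    using f by (auto simp: affine_functions_def)
  have "openin ?K {w \<in> topspace ?K. f w \<in> {m<..}}"
    by (rule openin_continuous_map_preimage[OF cont]) simp
  moreover have "v \<in> {w \<in> topspace ?K. f w \<in> {m<..}}" using v \<open>\<not> f v \<le> m\<close> by simp
  ultimately obtain J :: "'a set set set" and a d where J: "finite J" "\<And>j. j \<in> J \<Longrightarrow> 0 \<le> a j"
    "(\<Sum>j\<in>J. a j) = (1::real)" "\<And>j. j \<in> J \<Longrightarrow> d j \<in> D"
    "(\<Sum>j\<in>J. a j *\<^sub>R dirac X (e (d j))) \<in> {w \<in> topspace ?K. f w \<in> {m<..}}"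
    by (rule dirac_combinations_dense) blast
  have "convex {w \<in> topspace ?K. f w \<le> m}"
    unfolding convex_alt
  proof (intro ballI allI impI)
    fix x y and t :: real
    assume xy: "x \<in> {w \<in> topspace ?K. f w \<le> m}" "y \<in> {w \<in> topspace ?K. f w \<le> m}"
      and t: "0 \<le> t \<and> t \<le> 1"
    have "(1 - t) *\<^sub>R x + t *\<^sub>R y \<in> topspace ?K"
      using convex_radon xy t unfolding convex_alt topspace_prob_measures by blast
    moreover have "(1 - t) * f x + t * f y \<le> (1 - t) * m + t * m"
      using xy t by (intro add_mono mult_left_mono) auto
    ultimately show "(1 - t) *\<^sub>R x + t *\<^sub>R y \<in> {w \<in> topspace ?K. f w \<le> m}"
      using affine[of x y t] xy t by (simp add: algebra_simps)
  qed
  then have "(\<Sum>j\<in>J. a j *\<^sub>R dirac X (e (d j))) \<in> {w \<in> topspace ?K. f w \<le> m}"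
  proof (rule convex_sum[OF J(1) _ J(3,2)])
    fix j assume "j \<in> J"
    then have "d j \<in> D" by (rule J(4))
    then have "e (d j) \<in> topspace X" using embed by auto
    then show "dirac X (e (d j)) \<in> {w \<in> topspace ?K. f w \<le> m}"
      using m[OF \<open>d j \<in> D\<close>] dirac_in_prob_measures by simp
  qed
  then show False using J(5) by simp
qed

lemma boundary_countable_part:
  assumes "D \<noteq> {}"
  shows "boundary_of_compactum (prob_measures X) (dirac X ` countable_part)"
  unfolding boundary_of_compactum_def
proof (intro conjI ballI)
  show "dirac X ` countable_part \<subseteq> topspace (prob_measures X)"
    using countable_part_subset dirac_in_prob_measures by blast
  fix f assume f: "f \<in> affine_functions (prob_measures X)"
  then have "continuous_map (prob_measures X) euclideanreal f" by (simp add: affine_functions_def)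
  moreover have "continuous_map X (prob_measures X) (dirac X)"
    using embedding_map_dirac homeomorphic_imp_continuous_map continuous_map_into_fulltopology
    unfolding embedding_map_def by blast
  ultimately have "continuous_map X euclideanreal (f \<circ> dirac X)"
    using continuous_map_compose by blast
  then obtain b where b: "b \<in> countable_part" "\<And>d. d \<in> D \<Longrightarrow> (f \<circ> dirac X) (e d) \<le> (f \<circ> dirac X) b"
    using countable_part_attains_max assms by blast
  then have "\<forall>x\<in>topspace (prob_measures X). f x \<le> f (dirac X b)"
    using affine_le[OF f, of "f (dirac X b)"] by simp
  then show "\<exists>b\<in>dirac X ` countable_part. \<forall>x\<in>topspace (prob_measures X). f x \<le> f b"
    using b(1) by blast
qed

end

section \<open>Cardinal arithmetic\<close>

lemma card_of_singleton_bound: "Cinfinite r \<Longrightarrow> |{x}| \<le>o r"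
  by (rule Card_order_singl_ordLeq) (auto simp: cinfinite_def)

text \<open>Count by size: a set with \<open>n + 1\<close> elements arises from one of its elements
  and a set with \<open>n\<close> elements. An infinite cardinal absorbs the resulting products and
  the countable union over all sizes.\<close>

lemma card_of_Fpow_bound:
  assumes "|A| \<le>o r" "Cinfinite r"
  shows "|Fpow A| \<le>o r"
proof -
  define F where "F n = {X. X \<subseteq> A \<and> finite X \<and> card X = n}" for n
  have "|F n| \<le>o r" for n
  proof (induction n)
    case 0
    have "F 0 = {{}}" by (auto simp: F_def)
    then show ?case using card_of_singleton_bound[OF assms(2)] by simp
  next
    case (Suc n)
    have "F (Suc n) \<subseteq> (\<lambda>q. insert (fst q) (snd q)) ` (A \<times> F n)"
    proof
      fix X assume "X \<in> F (Suc n)"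
      then have X: "X \<subseteq> A" "finite X" "card X = Suc n" by (auto simp: F_def)
      then obtain a where a: "a \<in> X" by fastforce
      have "(a, X - {a}) \<in> A \<times> F n" using X a by (auto simp: F_def)
      moreover have "X = insert (fst (a, X - {a})) (snd (a, X - {a}))" using a by auto
      ultimately show "X \<in> (\<lambda>q. insert (fst q) (snd q)) ` (A \<times> F n)" by (rule rev_image_eqI)
    qed
    then have "|F (Suc n)| \<le>o |A \<times> F n|"
      by (rule ordLeq_transitive[OF card_of_mono1 card_of_image])
    also have "|A \<times> F n| \<le>o r"
      using assms Suc by (intro card_of_Times_ordLeq_infinite_Field) (auto simp: cinfinite_def)
    finally show ?case .
  qed
  moreover have "|UNIV :: nat set| \<le>o r"
    using natLeq_ordLeq_cinfinite[OF assms(2)] card_of_nat ordIso_ordLeq_trans by blast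
  ultimately have "|\<Union>n. F n| \<le>o r"
    using assms(2) by (intro UNION_Cinfinite_bound) auto
  moreover have "Fpow A = (\<Union>n. F n)" by (auto simp: Fpow_def F_def)
  ultimately show ?thesis by simp
qed

lemma card_of_Pow_mono:
  assumes "|A| \<le>o |B|" shows "|Pow A| \<le>o |Pow B|"
proof -
  obtain f where f: "inj_on f A" "f ` A \<subseteq> B" using assms card_of_ordLeq[of A B] by blast
  have "inj_on ((`) f) (Pow A)" using f(1) by (rule inj_on_image_Pow)
  moreover have "(`) f ` Pow A \<subseteq> Pow B" using f(2) by blast
  ultimately show ?thesis using card_of_ordLeq[of "Pow A" "Pow B"] by blast
qed

lemma Cinfinite_card_of: "infinite A \<Longrightarrow> Cinfinite |A|"
  by (simp add: cinfinite_def Field_card_of card_of_card_order_on)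

text \<open>\<open>min_card\<close> is defined by \<open>SOME\<close>, so a witness for
  \<open>P\<close> is what makes its value meaningful; the minimum then exists by the well-ordering
  of cardinals.\<close>

lemma min_card_least:
  assumes "P A\<^sub>0"
  obtains A where "P A" "min_card P = |A|" "\<And>A'. P A' \<Longrightarrow> |A| \<le>o |A'|"
proof -
  have "\<exists>r\<in>card_of ` {A. P A}. \<forall>r'\<in>card_of ` {A. P A}. r \<le>o r'"
    by (rule exists_minim_Card_order) (use assms card_of_Card_order in blast)+
  then have "\<exists>A. P A \<and> (\<forall>A'. P A' \<longrightarrow> |A| \<le>o |A'| )" by blast
  from someI_ex[OF this] show ?thesis by (intro that) (auto simp: min_card_def)
qed

lemma min_card_csum_le:
  assumes "P A\<^sub>0" "|A\<^sub>0| \<le>o r" "Cinfinite r"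
  shows "min_card P +c natLeq \<le>o r"
proof -
  obtain A where A: "min_card P = |A|" "\<And>A'. P A' \<Longrightarrow> |A| \<le>o |A'|"
    using min_card_least[of P, OF assms(1)] by metis
  have "|A| \<le>o r" using A(2)[OF assms(1)] assms(2) by (rule ordLeq_transitive)
  then show ?thesis
    unfolding A(1) using assms(3) natLeq_ordLeq_cinfinite[OF assms(3)] natLeq_Card_order
    by (intro csum_cinfinite_bound card_of_Card_order) auto
qed

lemma min_card_csum_eq:
  fixes r :: "'r rel"
  assumes "P A\<^sub>0" "|A\<^sub>0| \<le>o r" "Cinfinite r" "\<And>A. P A \<Longrightarrow> r \<le>o |A|"
  shows "min_card P +c natLeq =o r"
proof -
  obtain A where A: "P A" "min_card P = |A|"
    using min_card_least[of P, OF assms(1)] by metis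
  have "r \<le>o min_card P +c natLeq"
    unfolding A(2) using assms(4)[OF A(1)] ordLeq_csum1[OF card_of_Card_order] by (rule ordLeq_transitive)
  then show ?thesis using min_card_csum_le[where P = P, OF assms(1-3)] by (simp add: ordIso_iff_ordLeq)
qed

lemma Cinfinite_continuum: "Cinfinite continuum"
  unfolding continuum_def
  by (intro Cinfinite_cexp natLeq_Cinfinite ordLeq_refl Card_order_ctwo)

text \<open>Supplies the discrete space for the existential part of the theorem.\<close>

lemma card_of_reals: "|UNIV :: real set| =o continuum"
proof -
  have "|UNIV :: real set| =o |Pow (UNIV :: nat set)|"
    using nat_sets_eqpoll_reals by (simp add: eqpoll_iff_card_of_ordIso ordIso_symmetric)
  also have "|Pow (UNIV :: nat set)| =o |Func (UNIV :: nat set) (UNIV :: bool set)|"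
    by (rule card_of_Pow_Func)
  also have "|Func (UNIV :: nat set) (UNIV :: bool set)| = continuum"
    by (simp add: continuum_def cexp_def ctwo_def Field_natLeq Field_card_of)
  finally show ?thesis .
qed

lemma card_of_Pow_continuum:
  assumes "|D| =o continuum" shows "|Pow D| =o ctwo ^c continuum"
proof -
  have "|Pow D| =o |Func D (UNIV :: bool set)|" by (rule card_of_Pow_Func)
  also have "|Func D (UNIV :: bool set)| = ctwo ^c |D|"
    by (simp add: cexp_def ctwo_def Field_card_of)
  also have "ctwo ^c |D| =o ctwo ^c continuum"
    by (intro cexp_cong2 assms Card_order_ctwo card_of_Card_order)
  finally show ?thesis .
qed

text \<open>A nonempty countable subset is the range of a sequence in \<open>D\<close>, and the
  number of sequences is \<open>continuum ^c natLeq\<close>, which is again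
  \<open>continuum\<close>.\<close>

lemma card_of_countable_subsets:
  assumes "|D| =o continuum"
  shows "|{A. A \<subseteq> D \<and> countable A}| \<le>o continuum"
proof -
  have "|Func (UNIV :: nat set) D| = |D| ^c |UNIV :: nat set|"
    by (simp add: cexp_def Field_card_of)
  also have "|D| ^c |UNIV :: nat set| =o continuum ^c natLeq"
    by (intro cexp_cong assms card_of_nat natLeq_Card_order card_of_Card_order)
  also have "continuum ^c natLeq =o continuum"
    unfolding continuum_def
    by (intro cexp_cprod_ordLeq Card_order_ctwo natLeq_Cinfinite Cinfinite_Cnotzero
        ordLeq_refl natLeq_Card_order)
  finally have F: "|Func (UNIV :: nat set) D| \<le>o continuum" by (rule ordIso_imp_ordLeq)
  have "{A. A \<subseteq> D \<and> countable A} \<subseteq> {{}} \<union> range ` Func (UNIV :: nat set) D"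
  proof
    fix A assume "A \<in> {A. A \<subseteq> D \<and> countable A}"
    then have A: "A \<subseteq> D" "countable A" by auto
    show "A \<in> {{}} \<union> range ` Func (UNIV :: nat set) D"
    proof (cases "A = {}")
      case False
      then have "range (from_nat_into A) = A" using A(2) by (rule range_from_nat_into)
      moreover from this have "from_nat_into A \<in> Func UNIV D" using A(1) by (auto simp: Func_def)
      ultimately show ?thesis by (metis UnI2 image_eqI)
    qed simp
  qed
  then have "|{A. A \<subseteq> D \<and> countable A}| \<le>o |{{}} \<union> range ` Func (UNIV :: nat set) D|"
    by (rule card_of_mono1)
  also have "|{{}} \<union> range ` Func (UNIV :: nat set) D| \<le>o continuum"
  proof (rule Un_Cinfinite_bound[OF _ _ Cinfinite_continuum])
    show "|{{}}| \<le>o continuum" by (rule card_of_singleton_bound[OF Cinfinite_continuum])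
    show "|range ` Func (UNIV :: nat set) D| \<le>o continuum"
      by (rule ordLeq_transitive[OF card_of_image F])
  qed
  finally show ?thesis .
qed

section \<open>Bases and networks\<close>

lemma base_ofI:
  assumes "\<And>B. B \<in> \<B> \<Longrightarrow> openin X B"
    and "\<And>U p. openin X U \<Longrightarrow> p \<in> U \<Longrightarrow> \<exists>B\<in>\<B>. p \<in> B \<and> B \<subseteq> U"
  shows "base_of X \<B>"
  unfolding base_of_def
proof (intro conjI ballI allI impI)
  fix U assume "openin X U"
  then have "\<Union>{B \<in> \<B>. B \<subseteq> U} = U" using assms(2) by blast
  then show "\<exists>\<B>'\<subseteq>\<B>. \<Union>\<B>' = U" by (intro exI[of _ "{B \<in> \<B>. B \<subseteq> U}"]) auto
qed (rule assms(1))

lemma base_of_openin: "base_of X \<B> \<Longrightarrow> B \<in> \<B> \<Longrightarrow> openin X B"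
  by (simp add: base_of_def)

lemma base_of_nbhd:
  assumes "base_of X \<B>" "openin X U" "p \<in> U"
  shows "\<exists>B\<in>\<B>. p \<in> B \<and> B \<subseteq> U"
proof -
  have "\<exists>\<B>'\<subseteq>\<B>. \<Union>\<B>' = U" using assms(1,2) by (simp add: base_of_def)
  then obtain \<B>' where \<B>': "\<B>' \<subseteq> \<B>" "\<Union>\<B>' = U" by (elim exE conjE)
  then obtain B where "B \<in> \<B>'" "p \<in> B" using assms(3) by auto
  then show ?thesis using \<B>' by auto
qed

lemma base_of_imp_network_of: "base_of X \<B> \<Longrightarrow> network_of X \<B>"
  by (simp add: base_of_def network_of_def openin_subset)

lemma cozero_in_imp_openin:
  assumes "cozero_in X U" shows "openin X U"
proof -
  obtain f where f: "continuous_map X euclideanreal f" "U = topspace X - {x \<in> topspace X. f x = 0}"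
    using assms unfolding cozero_in_def by blast
  have "U = {x \<in> topspace X. f x \<in> - {0}}" using f(2) by auto
  moreover have "openin X {x \<in> topspace X. f x \<in> - {0}}"
    by (rule openin_continuous_map_preimage[OF f(1)]) (simp add: open_Compl)
  ultimately show ?thesis by simp
qed

text \<open>The crudest cz-network; with \<open>card_open_countable_part\<close> it is still small
  enough for the upper bound.\<close>

lemma cz_network_of_open_sets: "cz_network_of X {U. openin X U}"
  unfolding cz_network_of_def
proof (intro conjI ballI allI impI)
  fix U assume "cozero_in X U"
  then show "\<exists>\<N>'\<subseteq>{U. openin X U}. countable \<N>' \<and> \<Union>\<N>' = U"
    by (intro exI[of _ "{U}"]) (simp add: cozero_in_imp_openin)
qed (auto dest: openin_subset)

lemma base_of_homeomorphic_image:
  assumes h: "homeomorphic_map X Y h" and B: "base_of X \<B>"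
  shows "base_of Y ((`) h ` \<B>)"
proof (rule base_ofI)
  fix C assume "C \<in> (`) h ` \<B>"
  then obtain B where "B \<in> \<B>" "C = h ` B" by blast
  then show "openin Y C"
    using base_of_openin[OF B] homeomorphic_imp_open_map[OF h] by (simp add: open_map_def)
next
  fix U q assume U: "openin Y U" "q \<in> U"
  then have "q \<in> h ` topspace X"
    using homeomorphic_imp_surjective_map[OF h] openin_subset by blast
  then obtain p where p: "p \<in> topspace X" "q = h p" by blast
  have "openin X {x \<in> topspace X. h x \<in> U}"
    using openin_continuous_map_preimage[OF homeomorphic_imp_continuous_map[OF h] U(1)] .
  moreover have "p \<in> {x \<in> topspace X. h x \<in> U}" using p U(2) by simp
  ultimately have "\<exists>B\<in>\<B>. p \<in> B \<and> B \<subseteq> {x \<in> topspace X. h x \<in> U}"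
    by (rule base_of_nbhd[OF B])
  then obtain B where B': "B \<in> \<B>" "p \<in> B" "B \<subseteq> {x \<in> topspace X. h x \<in> U}"
    by (elim bexE conjE)
  show "\<exists>C\<in>(`) h ` \<B>. q \<in> C \<and> C \<subseteq> U"
    by (rule bexI[of _ "h ` B"]) (use B' p(2) in auto)
qed

text \<open>Boxes with rational end points. A box is coded by a finite set of triples of an index
  and two rationals, so there are at most as many boxes as finite subsets of a set no larger than
  \<open>r\<close>.\<close>

lemma functional_topology_base:
  fixes I :: "'i set"
  assumes "|I| \<le>o r" "Cinfinite r"
  obtains \<B> where "base_of (functional_topology V I L) \<B>" "|\<B>| \<le>o r"
proof -
  let ?T = "functional_topology V I L"
  define box where
    "box G = {v \<in> V. \<forall>t\<in>G. L (fst t) v \<in> {of_rat (fst (snd t))<..<of_rat (snd (snd t))}}"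
    for G :: "('i \<times> rat \<times> rat) set"
  define \<B> where "\<B> = box ` Fpow (I \<times> UNIV)"
  have "base_of ?T \<B>"
  proof (rule base_ofI)
    fix B assume "B \<in> \<B>"
    then obtain G where G: "B = box G" "G \<subseteq> I \<times> UNIV" "finite G" by (auto simp: \<B>_def Fpow_def)
    let ?o = "\<lambda>t. {v \<in> topspace ?T. L (fst t) v \<in> {of_rat (fst (snd t))<..<of_rat (snd (snd t))}}"
    have o: "openin ?T (?o t)" if "t \<in> G" for t
      using G(2) that by (intro openin_continuous_map_preimage[OF continuous_map_functional]) auto
    have "openin ?T (topspace ?T \<inter> (\<Inter>t\<in>G. ?o t))"
    proof (cases "G = {}")
      case False
      then show ?thesis using o G(3) by (intro openin_Int openin_topspace openin_INT2) auto
    qed (use openin_topspace[of ?T] in simp)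
    moreover have "topspace ?T \<inter> (\<Inter>t\<in>G. ?o t) = B" by (auto simp: G(1) box_def)
    ultimately show "openin ?T B" by simp
  next
    fix U v assume U: "openin ?T U" "v \<in> U"
    obtain F \<epsilon> where F: "finite F" "F \<subseteq> I" "0 < \<epsilon>" "{w \<in> V. \<forall>i\<in>F. \<bar>L i w - L i v\<bar> < \<epsilon>} \<subseteq> U"
      using functional_topology_nbhd[OF U] .
    have "\<exists>a b. L i v - \<epsilon> < of_rat a \<and> of_rat a < L i v \<and> L i v < of_rat b \<and> of_rat b < L i v + \<epsilon>" for i
      using of_rat_dense[of "L i v - \<epsilon>" "L i v"] of_rat_dense[of "L i v" "L i v + \<epsilon>"] F(3) by auto
    then obtain a b where ab: "\<And>i. L i v - \<epsilon> < of_rat (a i)" "\<And>i. of_rat (a i) < L i v"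
      "\<And>i. L i v < of_rat (b i)" "\<And>i. of_rat (b i) < L i v + \<epsilon>" by metis
    define G where "G = (\<lambda>i. (i, a i, b i)) ` F"
    have "box G \<in> \<B>" using F(1,2) by (auto simp: \<B>_def Fpow_def G_def)
    moreover have "v \<in> box G"
      using U openin_subset[OF U(1)] ab(2,3) by (auto simp: box_def G_def)
    moreover have "box G \<subseteq> {w \<in> V. \<forall>i\<in>F. \<bar>L i w - L i v\<bar> < \<epsilon>}"
    proof
      fix w assume w: "w \<in> box G"
      have "\<bar>L i w - L i v\<bar> < \<epsilon>" if "i \<in> F" for i
      proof -
        have "of_rat (a i) < L i w" "L i w < of_rat (b i)"
          using w that by (auto simp: box_def G_def)
        then show ?thesis using ab[of i] by linarith
      qed
      then show "w \<in> {w \<in> V. \<forall>i\<in>F. \<bar>L i w - L i v\<bar> < \<epsilon>}" using w by (simp add: box_def)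
    qed
    ultimately show "\<exists>B\<in>\<B>. v \<in> B \<and> B \<subseteq> U" using F(4) by (meson order_trans)
  qed
  moreover have "|\<B>| \<le>o r"
  proof -
    have "|UNIV :: (rat \<times> rat) set| \<le>o |UNIV :: nat set|"
      using uncountable_def[of "UNIV :: (rat \<times> rat) set"] card_of_ordLeq[of "UNIV :: (rat \<times> rat) set" "UNIV :: nat set"]
        countableI_type[of "UNIV :: (rat \<times> rat) set"] unfolding countable_def by auto
    also have "|UNIV :: nat set| \<le>o r"
      using natLeq_ordLeq_cinfinite[OF assms(2)] card_of_nat ordIso_ordLeq_trans by blast
    finally have "|I \<times> (UNIV :: (rat \<times> rat) set)| \<le>o r"
      using assms by (intro card_of_Times_ordLeq_infinite_Field) (auto simp: cinfinite_def)
    then have "|Fpow (I \<times> (UNIV :: (rat \<times> rat) set))| \<le>o r"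
      using assms(2) by (rule card_of_Fpow_bound)
    then show ?thesis unfolding \<B>_def by (rule ordLeq_transitive[OF card_of_image])
  qed
  ultimately show ?thesis using that by blast
qed

section \<open>Weights of the spaces involved\<close>

lemma infinite_continuum: "|D| =o continuum \<Longrightarrow> infinite D"
  using Cinfinite_continuum Cinfinite_cong[OF ordIso_symmetric[of "|D|" continuum]]
  by (simp add: cinfinite_def Field_card_of)

context discrete_beta
begin

text \<open>Compactness of \<open>clp A\<close>, translated back to subsets of \<open>D\<close> by
  looking only at the points \<open>e d\<close>.\<close>

lemma clp_finite_subcover:
  assumes "A \<subseteq> D" "\<C> \<subseteq> Pow D" and cover: "\<And>p. p \<in> clp A \<Longrightarrow> \<exists>C\<in>\<C>. p \<in> clp C"
  obtains F where "finite F" "F \<subseteq> \<C>" "A \<subseteq> \<Union>F"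
proof -
  have "\<exists>\<F>. finite \<F> \<and> \<F> \<subseteq> clp ` \<C> \<and> clp A \<subseteq> \<Union>\<F>"
  proof (rule compactinD[OF compactin_clp])
    show "openin X U" if "U \<in> clp ` \<C>" for U using that assms(2) clp_open by auto
    show "clp A \<subseteq> \<Union> (clp ` \<C>)" using cover by auto
  qed
  then obtain \<F> where F: "finite \<F>" "\<F> \<subseteq> clp ` \<C>" "clp A \<subseteq> \<Union>\<F>" by (elim exE conjE)
  from finite_subset_image[OF F(1,2)]
  obtain F where F': "F \<subseteq> \<C>" "finite F" "\<F> = clp ` F" by (elim exE conjE)
  have "A \<subseteq> \<Union>F"
  proof
    fix d assume "d \<in> A"
    then have "e d \<in> \<Union>\<F>" using F(3) clp_point assms(1) by blast
    then obtain C where C: "C \<in> F" "e d \<in> clp C" using F'(3) by auto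
    have "d \<in> C"
      using clp_point_iff[of d C] C \<open>d \<in> A\<close> assms(1,2) F'(1) by auto
    then show "d \<in> \<Union>F" using C(1) by blast
  qed
  then show ?thesis using that F' by simp
qed

text \<open>Intersecting with \<open>D\<close> gives the empty family the value \<open>D\<close>
  instead of \<open>UNIV\<close>.\<close>

lemma clp_Inter:
  assumes "finite G" "G \<subseteq> Pow D" "p \<in> topspace X" "\<And>B. B \<in> G \<Longrightarrow> p \<in> clp B"
  shows "p \<in> clp (D \<inter> \<Inter>G)"
  using assms
proof (induction G rule: finite_induct)
  case empty
  then show ?case by (simp add: clp_D)
next
  case (insert B G)
  have "p \<in> clp (D \<inter> \<Inter>G)" using insert.prems by (intro insert.IH) auto
  moreover have "p \<in> clp B" "B \<subseteq> D" using insert.prems by auto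
  moreover have "D \<inter> \<Inter>(insert B G) = (D \<inter> \<Inter>G) \<inter> B" by auto
  ultimately show ?case using clp_Int[of "D \<inter> \<Inter>G" B] by simp
qed

section \<open>Bases and networks of the countable part\<close>

lemma embed_in_countable_part: "d \<in> D \<Longrightarrow> e d \<in> countable_part"
  unfolding countable_part_def by (rule UN_I[of "{d}"]) (simp_all add: clp_point)

lemma clp_subset_countable_part: "A \<subseteq> D \<Longrightarrow> countable A \<Longrightarrow> clp A \<subseteq> countable_part"
  unfolding countable_part_def by (rule UN_upper) simp

text \<open>Intersecting a clopen neighbourhood \<open>clp B\<close> of \<open>p\<close> with
  \<open>clp A\<close>, for a countable \<open>A\<close> with \<open>p \<in> clp A\<close>, yields
  the smaller neighbourhood \<open>clp (A \<inter> B)\<close>, which comes from a countable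
  set.\<close>

lemma base_countable_part:
  "base_of (subtopology X countable_part) (clp ` {A. A \<subseteq> D \<and> countable A})"
proof (rule base_ofI)
  fix B assume "B \<in> clp ` {A. A \<subseteq> D \<and> countable A}"
  then show "openin (subtopology X countable_part) B"
    using clp_open clp_subset_countable_part by (auto simp: openin_subtopology)
next
  fix U p assume U: "openin (subtopology X countable_part) U" and p: "p \<in> U"
  obtain W where W: "openin X W" "U = W \<inter> countable_part"
    using U unfolding openin_subtopology by blast
  obtain A where A: "A \<subseteq> D" "countable A" "p \<in> clp A"
    using p W(2) by (auto simp: countable_part_def)
  obtain B where B: "B \<subseteq> D" "p \<in> clp B" "clp B \<subseteq> W"
    using clp_nbhd[OF W(1), of p] p W(2) by blast
  have AB: "A \<inter> B \<subseteq> D" "countable (A \<inter> B)" using A by auto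
  have "p \<in> clp (A \<inter> B)" using A B clp_Int[of A B] by simp
  moreover have "clp (A \<inter> B) \<subseteq> U"
    using W(2) B(3) clp_mono[of "A \<inter> B" B] clp_subset_countable_part[OF AB] by auto
  ultimately show "\<exists>B\<in>clp ` {A. A \<subseteq> D \<and> countable A}. p \<in> B \<and> B \<subseteq> U"
    using AB by (intro bexI[of _ "clp (A \<inter> B)"]) auto
qed

text \<open>The points \<open>e d\<close> are isolated, and a network must contain the singleton of
  every isolated point.\<close>

lemma network_countable_part_lower:
  assumes "network_of (subtopology X countable_part) \<N>"
  shows "|D| \<le>o |\<N>|"
proof -
  have "{e d} \<in> \<N>" if d: "d \<in> D" for d
  proof -
    have cd: "clp {d} = {e d}" using clp_finite[of "{d}"] d by simp
    have "openin (subtopology X countable_part) (clp {d})"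
      using d by (intro base_of_openin[OF base_countable_part]) auto
    then have "\<exists>\<N>'\<subseteq>\<N>. \<Union>\<N>' = {e d}"
      using assms unfolding network_of_def cd by blast
    then obtain \<N>' where N: "\<N>' \<subseteq> \<N>" "\<Union>\<N>' = {e d}" by (elim exE conjE)
    then obtain N where "N \<in> \<N>'" "e d \<in> N" by (metis UnionE singletonI)
    moreover from this have "N = {e d}" using N(2) by auto
    ultimately show ?thesis using N(1) by auto
  qed
  then have "(\<lambda>d. {e d}) ` D \<subseteq> \<N>" by auto
  moreover have "inj_on (\<lambda>d. {e d}) D" using inj_embed by (auto simp: inj_on_def)
  ultimately show ?thesis using card_of_ordLeq[of D \<N>] by blast
qed

lemma card_open_countable_part:
  "|{U. openin (subtopology X countable_part) U}| \<le>o |Pow {A. A \<subseteq> D \<and> countable A}|"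
proof -
  let ?\<A> = "{A. A \<subseteq> D \<and> countable A}"
  have "{U. openin (subtopology X countable_part) U} \<subseteq> (\<lambda>\<S>. \<Union>(clp ` \<S>)) ` Pow ?\<A>"
  proof
    fix U assume "U \<in> {U. openin (subtopology X countable_part) U}"
    then obtain \<B> where B: "\<B> \<subseteq> clp ` ?\<A>" "\<Union>\<B> = U"
      using base_countable_part unfolding base_of_def by blast
    then obtain \<S> where "\<S> \<subseteq> ?\<A>" "\<B> = clp ` \<S>" unfolding subset_image_iff by blast
    then show "U \<in> (\<lambda>\<S>. \<Union>(clp ` \<S>)) ` Pow ?\<A>" using B(2) by blast
  qed
  then show ?thesis by (rule ordLeq_transitive[OF card_of_mono1 card_of_image])
qed

text \<open>Otherwise each member of the countable cover of \<open>clp A \<inter> countable_part\<close> misses some clopen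
  neighbourhood of \<open>p\<close>; a sequence running through the finite intersections of these neighbourhoods
  clusters at a point of \<open>countable_part\<close> that is not covered.\<close>

lemma cz_network_closure:
  assumes cz: "cz_network_of (subtopology X countable_part) \<N>"
    and A: "A \<subseteq> D" and p: "p \<in> clp A"
  shows "\<exists>N\<in>\<N>. p \<in> X closure_of N \<and> X closure_of N \<subseteq> clp A"
proof (rule ccontr)
  assume none: "\<not> ?thesis"
  have "cozero_in (subtopology X countable_part) (clp A \<inter> countable_part)"
    unfolding cozero_in_def
  proof (intro exI conjI)
    show "continuous_map (subtopology X countable_part) euclideanreal (indicator (clp A))"
      by (rule continuous_map_from_subtopology[OF continuous_indicator_clp[OF A]])
  qed (use clp_subset[of A] in \<open>auto simp: indicator_def\<close>)
  then have "\<exists>\<N>'\<subseteq>\<N>. countable \<N>' \<and> \<Union>\<N>' = clp A \<inter> countable_part"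
    using cz unfolding cz_network_of_def by blast
  then obtain \<N>' where N: "\<N>' \<subseteq> \<N>" "countable \<N>'" "\<Union>\<N>' = clp A \<inter> countable_part"
    by (elim exE conjE)
  \<comment> \<open>Nonemptiness is what allows the countable cover to be written as the range of a
    sequence.\<close>
  have "A \<noteq> {}" using p by auto
  then obtain c where "c \<in> A" by blast
  then have "e c \<in> \<Union>\<N>'" unfolding N(3) using A clp_point embed_in_countable_part by blast
  then have "\<N>' \<noteq> {}" by blast
  then obtain N :: "nat \<Rightarrow> 'b set" where N': "\<N>' = range N"
    using N(2) range_from_nat_into[of \<N>'] by metis
  have "\<exists>B. B \<subseteq> D \<and> p \<in> clp B \<and> clp B \<inter> N i = {}" for i :: nat
  proof -
    have Ni: "N i \<subseteq> clp A" using N(3) N' by blast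
    \<comment> \<open>The inclusion holds for every member of the cover, so \<open>none\<close> can
      only mean that \<open>p\<close> is outside the closure.\<close>
    then have "X closure_of (N i) \<subseteq> clp A" using clp_closed by (rule closure_of_minimal)
    moreover have "N i \<in> \<N>" using N(1) N' by blast
    ultimately have "p \<notin> X closure_of (N i)" using none by blast
    then have "p \<in> topspace X - X closure_of (N i)" using p clp_subset by blast
    moreover have "openin X (topspace X - X closure_of (N i))"
      by (intro openin_diff openin_topspace closedin_closure_of)
    ultimately obtain B where B: "B \<subseteq> D" "p \<in> clp B" "clp B \<subseteq> topspace X - X closure_of (N i)"
      using clp_nbhd by metis
    have "N i \<subseteq> X closure_of (N i)"
      using Ni clp_subset by (intro closure_of_subset) blast
    then have "clp B \<inter> N i = {}" using B(3) by blast
    then show ?thesis using B by blast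
  qed
  then obtain B where B: "\<And>i. B i \<subseteq> D" "\<And>i. p \<in> clp (B i)" "\<And>i. clp (B i) \<inter> N i = {}"
    by metis
  have ne: "A \<inter> (\<Inter>i\<le>n. B i) \<noteq> {}" for n
  proof -
    have "p \<in> clp (D \<inter> \<Inter>(insert A (B ` {..n})))"
      using A B p clp_subset[of A] by (intro clp_Inter) auto
    then have "D \<inter> \<Inter>(insert A (B ` {..n})) \<noteq> {}" by (metis clp_empty empty_iff)
    then show ?thesis by auto
  qed
  define x where "x n = (SOME c. c \<in> A \<inter> (\<Inter>i\<le>n. B i))" for n
  have x: "x n \<in> A" "i \<le> n \<Longrightarrow> x n \<in> B i" for n i
    using some_in_eq[of "A \<inter> (\<Inter>i\<le>n. B i)"] ne[of n] unfolding x_def by auto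
  have "range x \<subseteq> D" using x(1) A by blast
  from sequence_cluster_point[OF this] obtain q where
    q: "q \<in> countable_part" "\<And>n. q \<in> clp (x ` {n..})" by blast
  have "q \<in> clp A" using q(2)[of 0] clp_mono[of "x ` {0..}" A] x(1) by blast
  then have "q \<in> \<Union>\<N>'" using q(1) N(3) by blast
  then obtain k where k: "q \<in> N k" using N' by blast
  \<comment> \<open>From index \<open>k\<close> on the sequence runs inside \<open>B k\<close>, so
    its cluster point lies in \<open>clp (B k)\<close>, which misses \<open>N k\<close>.\<close>
  have "q \<in> clp (B k)" using q(2)[of k] clp_mono[of "x ` {k..}" "B k"] x(2)[of k] by auto
  then show False using B(3)[of k] k by blast
qed

text \<open>Choosing a clopen separation for every pair of members of the network whose closures are
  disjoint gives few clopen sets, and by compactness they generate all of them.\<close>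

lemma cz_network_countable_part_lower:
  assumes cz: "cz_network_of (subtopology X countable_part) \<N>" and inf: "infinite D"
  shows "|Pow D| \<le>o |\<N>|"
proof -
  define sep where "sep q = (SOME B. B \<subseteq> D \<and> X closure_of (fst q) \<subseteq> clp B \<and>
      clp B \<subseteq> topspace X - X closure_of (snd q))" for q :: "'b set \<times> 'b set"
  \<comment> \<open>For a pair that admits no separation \<open>sep\<close> returns an arbitrary
    set; the intersection discards values outside \<open>D\<close>, and any other stray value is
    harmless for the count.\<close>
  define \<S> where "\<S> = sep ` (\<N> \<times> \<N>) \<inter> Pow D"
  have sep: "\<exists>B\<in>\<S>. p \<in> clp B \<and> q \<in> clp (D - B)"
    if A: "A \<subseteq> D" and p: "p \<in> clp A" and q: "q \<in> clp (D - A)" for A p q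
  proof -
    obtain M where M: "M \<in> \<N>" "p \<in> X closure_of M" "X closure_of M \<subseteq> clp A"
      using cz_network_closure[OF cz A p] by blast
    obtain N where N: "N \<in> \<N>" "q \<in> X closure_of N" "X closure_of N \<subseteq> clp (D - A)"
      using cz_network_closure[OF cz Diff_subset q] by blast
    have sub: "X closure_of M \<subseteq> topspace X - X closure_of N"
      using M(3) N(3) clp_compl[OF A] clp_subset[of A] by blast
    have M': "compactin X (X closure_of M)"
      by (rule closedin_compact_space[OF compact closedin_closure_of])
    have N': "openin X (topspace X - X closure_of N)"
      by (intro openin_diff openin_topspace closedin_closure_of)
    obtain B where "B \<subseteq> D" "X closure_of M \<subseteq> clp B" "clp B \<subseteq> topspace X - X closure_of N"
      using compactin_clp_interpolate[OF M' N' sub] .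
    then have "\<exists>B. B \<subseteq> D \<and> X closure_of (fst (M, N)) \<subseteq> clp B \<and>
        clp B \<subseteq> topspace X - X closure_of (snd (M, N))"
      by (intro exI[of _ B]) simp
    then have B: "sep (M, N) \<subseteq> D \<and> X closure_of (fst (M, N)) \<subseteq> clp (sep (M, N)) \<and>
        clp (sep (M, N)) \<subseteq> topspace X - X closure_of (snd (M, N))"
      unfolding sep_def by (rule someI_ex)
    have "sep (M, N) \<in> \<S>" using B M(1) N(1) by (simp add: \<S>_def)
    moreover have "p \<in> clp (sep (M, N))" using B M(2) by auto
    moreover have "q \<in> clp (D - sep (M, N))"
    proof -
      have "q \<in> topspace X" using q clp_subset by blast
      then show ?thesis using B N(2) clp_compl[of "sep (M, N)"] by auto
    qed
    ultimately show ?thesis by blast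
  qed
  have S: "\<S> \<subseteq> Pow D" by (simp add: \<S>_def)
  \<comment> \<open>The complements of the members of \<open>\<S>\<close> around \<open>p\<close>
    cover \<open>clp (D - A)\<close>. Finitely many suffice, and the corresponding members intersect
    in a neighbourhood of \<open>p\<close> inside \<open>clp A\<close>.\<close>
  have inter: "\<exists>G\<in>Fpow \<S>. p \<in> clp (D \<inter> \<Inter>G) \<and> D \<inter> \<Inter>G \<subseteq> A" if A: "A \<subseteq> D" and p: "p \<in> clp A" for A p
  proof -
    let ?\<C> = "(\<lambda>B. D - B) ` {B \<in> \<S>. p \<in> clp B}"
    obtain F where F: "finite F" "F \<subseteq> ?\<C>" "D - A \<subseteq> \<Union>F"
    proof (rule clp_finite_subcover[of "D - A" ?\<C>])
      show "\<exists>C\<in>?\<C>. q \<in> clp C" if "q \<in> clp (D - A)" for q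
        using sep[OF A p that] by blast
    qed auto
    from finite_subset_image[OF F(1,2)]
    obtain G where G: "G \<subseteq> {B \<in> \<S>. p \<in> clp B}" "finite G" "F = (\<lambda>B. D - B) ` G"
      by (elim exE conjE)
    have "p \<in> clp (D \<inter> \<Inter>G)"
      using G(1,2) S p clp_subset[of A] by (intro clp_Inter) auto
    moreover have "D \<inter> \<Inter>G \<subseteq> A" using F(3) G(3) by blast
    moreover have "G \<in> Fpow \<S>" using G(1,2) by (auto simp: Fpow_def)
    ultimately show ?thesis by blast
  qed
  \<comment> \<open>A second use of compactness: \<open>A\<close> is a finite union of such finite
    intersections, so a finite set of finite subsets of \<open>\<S>\<close> codes it.\<close>
  have "Pow D \<subseteq> (\<lambda>\<G>. \<Union>G\<in>\<G>. D \<inter> \<Inter>G) ` Fpow (Fpow \<S>)"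
  proof
    fix A assume "A \<in> Pow D"
    then have A: "A \<subseteq> D" by simp
    let ?\<C> = "(\<lambda>G. D \<inter> \<Inter>G) ` {G \<in> Fpow \<S>. D \<inter> \<Inter>G \<subseteq> A}"
    obtain F where F: "finite F" "F \<subseteq> ?\<C>" "A \<subseteq> \<Union>F"
    proof (rule clp_finite_subcover[of A ?\<C>])
      show "\<exists>C\<in>?\<C>. p \<in> clp C" if "p \<in> clp A" for p
        using inter[OF A that] by blast
    qed (use A in auto)
    from finite_subset_image[OF F(1,2)]
    obtain \<G> where G: "\<G> \<subseteq> {G \<in> Fpow \<S>. D \<inter> \<Inter>G \<subseteq> A}" "finite \<G>" "F = (\<lambda>G. D \<inter> \<Inter>G) ` \<G>"
      by (elim exE conjE)
    have "A = (\<Union>G\<in>\<G>. D \<inter> \<Inter>G)"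
    proof
      show "A \<subseteq> (\<Union>G\<in>\<G>. D \<inter> \<Inter>G)" using F(3) unfolding G(3) .
      show "(\<Union>G\<in>\<G>. D \<inter> \<Inter>G) \<subseteq> A" using G(1) by (intro UN_least) auto
    qed
    moreover have "\<G> \<in> Fpow (Fpow \<S>)" using G(1,2) by (auto simp: Fpow_def)
    ultimately show "A \<in> (\<lambda>\<G>. \<Union>G\<in>\<G>. D \<inter> \<Inter>G) ` Fpow (Fpow \<S>)" by (rule image_eqI)
  qed
  then have le: "|Pow D| \<le>o |Fpow (Fpow \<S>)|"
    by (rule ordLeq_transitive[OF card_of_mono1 card_of_image])
  \<comment> \<open>Needed for \<open>\<N> \<times> \<N>\<close> and the finite subsets to be no
    larger than \<open>\<N>\<close>; a finite network would leave only finitely many codes for the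
    infinitely many subsets of \<open>D\<close>.\<close>
  have N: "infinite \<N>"
  proof
    assume "finite \<N>"
    then have "finite (Fpow (Fpow \<S>))"
      by (simp add: \<S>_def finite_subset[OF Fpow_subset_Pow])
    then have "finite (Pow D)" using card_of_ordLeq_finite[OF le] by simp
    then show False using inf by simp
  qed
  then have C: "Cinfinite |\<N>|" by (rule Cinfinite_card_of)
  have "|\<S>| \<le>o |sep ` (\<N> \<times> \<N>)|" unfolding \<S>_def by (intro card_of_mono1) auto
  also have "|sep ` (\<N> \<times> \<N>)| \<le>o |\<N> \<times> \<N>|" by (rule card_of_image)
  also have "|\<N> \<times> \<N>| \<le>o |\<N>|"
    by (rule ordIso_imp_ordLeq[OF card_of_Times_same_infinite[OF N]])
  finally have "|Fpow (Fpow \<S>)| \<le>o |\<N>|" by (intro card_of_Fpow_bound C)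
  with le show ?thesis by (rule ordLeq_transitive)
qed

text \<open>The image of \<open>clp A\<close> is compact and relatively open, so finitely many basic
  sets cover it without picking up further points of the image of \<open>X\<close>. Their union
  determines \<open>A\<close> through the points \<open>h (e d)\<close>.\<close>

lemma base_lower:
  assumes h: "embedding_map X Y h" and B: "base_of Y \<B>" and inf: "infinite D"
  shows "|Pow D| \<le>o |\<B>|"
proof -
  have "Pow D \<subseteq> (\<lambda>F. {d \<in> D. h (e d) \<in> \<Union>F}) ` Fpow \<B>"
  proof
    fix A assume "A \<in> Pow D"
    then have A: "A \<subseteq> D" by simp
    have hom: "homeomorphic_map X (subtopology Y (h ` topspace X)) h"
      using h by (simp add: embedding_map_def)
    have "openin (subtopology Y (h ` topspace X)) (h ` clp A)"
      using homeomorphic_imp_open_map[OF hom] clp_open[OF A] by (simp add: open_map_def)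
    then obtain W where W: "openin Y W" "h ` clp A = W \<inter> h ` topspace X"
      unfolding openin_subtopology by blast
    have cont: "continuous_map X Y h"
      using homeomorphic_imp_continuous_map[OF hom] continuous_map_into_fulltopology by blast
    have "compactin Y (h ` clp A)" by (rule image_compactin[OF compactin_clp cont])
    then have "\<exists>\<F>. finite \<F> \<and> \<F> \<subseteq> {B \<in> \<B>. B \<subseteq> W} \<and> h ` clp A \<subseteq> \<Union>\<F>"
    proof (rule compactinD)
      show "openin Y U" if "U \<in> {B \<in> \<B>. B \<subseteq> W}" for U using base_of_openin[OF B] that by blast
      show "h ` clp A \<subseteq> \<Union>{B \<in> \<B>. B \<subseteq> W}"
      proof
        fix y assume "y \<in> h ` clp A"
        then have "y \<in> W" using W(2) by blast
        then show "y \<in> \<Union>{B \<in> \<B>. B \<subseteq> W}" using base_of_nbhd[OF B W(1)] by blast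
      qed
    qed
    then obtain \<F> where F: "finite \<F>" "\<F> \<subseteq> {B \<in> \<B>. B \<subseteq> W}" "h ` clp A \<subseteq> \<Union>\<F>"
      by (elim exE conjE)
    have inj: "inj_on h (topspace X)" using homeomorphic_imp_injective_map[OF hom] .
    have "h (e d) \<in> \<Union>\<F> \<longleftrightarrow> d \<in> A" if d: "d \<in> D" for d
    proof
      have X: "e d \<in> topspace X" using d embed by auto
      assume "h (e d) \<in> \<Union>\<F>"
      then have "h (e d) \<in> W" using F(2) by blast
      then have "h (e d) \<in> h ` clp A" using W(2) X by blast
      then have "e d \<in> clp A" using inj_on_image_mem_iff[OF inj X clp_subset] by simp
      then show "d \<in> A" using clp_point_iff[OF d A] by simp
    next
      assume "d \<in> A"
      then have "e d \<in> clp A" using A by (rule clp_point)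
      then show "h (e d) \<in> \<Union>\<F>" using F(3) by blast
    qed
    then have "A = {d \<in> D. h (e d) \<in> \<Union>\<F>}" using A by blast
    moreover have "\<F> \<in> Fpow \<B>" using F(1,2) by (auto simp: Fpow_def)
    ultimately show "A \<in> (\<lambda>F. {d \<in> D. h (e d) \<in> \<Union>F}) ` Fpow \<B>" by (rule image_eqI)
  qed
  then have le: "|Pow D| \<le>o |Fpow \<B>|"
    by (rule ordLeq_transitive[OF card_of_mono1 card_of_image])
  have "infinite \<B>"
  proof
    assume "finite \<B>"
    then have "finite (Fpow \<B>)" by (simp add: finite_subset[OF Fpow_subset_Pow])
    then have "finite (Pow D)" using card_of_ordLeq_finite[OF le] by simp
    then show False using inf by simp
  qed
  then have "|Fpow \<B>| \<le>o |\<B>|"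
    by (intro card_of_Fpow_bound Cinfinite_card_of ordLeq_refl card_of_Card_order)
  with le show ?thesis by (rule ordLeq_transitive)
qed

lemma weights:
  assumes D: "|D| =o continuum"
  shows "weight (prob_measures X) =o ctwo ^c continuum"
    and "weight (subtopology X countable_part) =o continuum"
    and "network_weight (subtopology X countable_part) =o continuum"
    and "cz_network_weight (subtopology X countable_part) =o ctwo ^c continuum"
    and "weight (subtopology (prob_measures X) (dirac X ` countable_part)) \<le>o continuum"
proof -
  let ?O = "subtopology X countable_part" and ?\<A> = "{A. A \<subseteq> D \<and> countable A}"
  note P = card_of_Pow_continuum[OF D] and C = Cinfinite_continuum
  have inf: "infinite D" by (rule infinite_continuum[OF D])
  have C2: "Cinfinite (ctwo ^c continuum)"
    by (intro Cinfinite_cexp C ordLeq_refl Card_order_ctwo)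
  have DC: "continuum \<le>o |D|" using D ordIso_iff_ordLeq by blast
  have A: "|?\<A>| \<le>o continuum" by (rule card_of_countable_subsets[OF D])
  have base: "|clp ` ?\<A>| \<le>o continuum" by (rule ordLeq_transitive[OF card_of_image A])
  have PD: "|Pow D| \<le>o ctwo ^c continuum" "ctwo ^c continuum \<le>o |Pow D|"
    using P ordIso_iff_ordLeq by blast+

  obtain \<B> where B: "base_of (prob_measures X) \<B>" "|\<B>| \<le>o ctwo ^c continuum"
    unfolding prob_measures_eq by (rule functional_topology_base[OF PD(1) C2])
  show "weight (prob_measures X) =o ctwo ^c continuum"
    unfolding weight_def
  proof (rule min_card_csum_eq[where P = "base_of (prob_measures X)", OF B C2])
    fix \<C> assume "base_of (prob_measures X) \<C>"
    then have "|Pow D| \<le>o |\<C>|" using embedding_map_dirac inf by (intro base_lower)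
    then show "ctwo ^c continuum \<le>o |\<C>|" by (rule ordLeq_transitive[OF PD(2)])
  qed

  have net: "continuum \<le>o |\<N>|" if "network_of ?O \<N>" for \<N>
    using DC network_countable_part_lower[OF that] by (rule ordLeq_transitive)
  show "weight ?O =o continuum"
    unfolding weight_def
    by (rule min_card_csum_eq[where P = "base_of ?O", OF base_countable_part base C]) (intro net base_of_imp_network_of)
  show "network_weight ?O =o continuum"
    unfolding network_weight_def
    by (rule min_card_csum_eq[where P = "network_of ?O", OF base_of_imp_network_of[OF base_countable_part] base C net])

  have "|?\<A>| \<le>o |D|" using A DC by (rule ordLeq_transitive)
  then have "|Pow ?\<A>| \<le>o ctwo ^c continuum"
    using card_of_Pow_mono PD(1) ordLeq_transitive by blast
  then have cz: "|{U. openin ?O U}| \<le>o ctwo ^c continuum"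
    by (rule ordLeq_transitive[OF card_open_countable_part])
  show "cz_network_weight ?O =o ctwo ^c continuum"
    unfolding cz_network_weight_def
  proof (rule min_card_csum_eq[where P = "cz_network_of ?O", OF cz_network_of_open_sets cz C2])
    fix \<N> assume "cz_network_of ?O \<N>"
    then have "|Pow D| \<le>o |\<N>|" using inf by (rule cz_network_countable_part_lower)
    then show "ctwo ^c continuum \<le>o |\<N>|" by (rule ordLeq_transitive[OF PD(2)])
  qed

  \<comment> \<open>The boundary lives in \<open>K\<close> as a set of Dirac measures, so the base
    is carried over along the embedding. An upper bound is all that the strict comparison of weights
    requires.\<close>
  let ?K = "prob_measures X"
  have "homeomorphic_map X (subtopology ?K (dirac X ` topspace X)) (dirac X)"
    using embedding_map_dirac by (simp add: embedding_map_def)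
  then have "homeomorphic_map ?O
      (subtopology (subtopology ?K (dirac X ` topspace X)) (dirac X ` countable_part)) (dirac X)"
    by (rule homeomorphic_map_subtopologies)
      (use countable_part_subset dirac_in_prob_measures in \<open>auto simp: Int_absorb1\<close>)
  moreover have "subtopology (subtopology ?K (dirac X ` topspace X)) (dirac X ` countable_part)
      = subtopology ?K (dirac X ` countable_part)"
    using countable_part_subset by (simp add: subtopology_subtopology Int_absorb1 image_mono)
  ultimately have "homeomorphic_map ?O (subtopology ?K (dirac X ` countable_part)) (dirac X)" by simp
  from base_of_homeomorphic_image[OF this base_countable_part]
  show "weight (subtopology ?K (dirac X ` countable_part)) \<le>o continuum"
    unfolding weight_def
    by (rule min_card_csum_le[where P = "base_of (subtopology ?K (dirac X ` countable_part))", OF _ ordLeq_transitive[OF card_of_image base] C])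
qed

end

lemma countable_part_stone_cech:
  "discrete_beta.countable_part (stone_cech (discrete_topology D)) D (beta_embed (discrete_topology D))
     = D_omega D"
proof -
  interpret discrete_beta "stone_cech (discrete_topology D)" D "beta_embed (discrete_topology D)"
    by (rule discrete_beta_stone_cech)
  show ?thesis by (auto simp: countable_part_def D_omega_def clp_def Let_def)
qed

text \<open>The identification of \<beta>D with the Dirac measures is the conjunct
  \<open>embedding_map\<close>. The universal part ranges over subsets of an arbitrary type, which
  may contain none of size \<open>continuum\<close>; the existential part is therefore stated over
  the reals, where one exists.\<close>

theorem mainTheorem5:
  shows "(\<forall>D :: 'a set. |D| =o continuum \<longrightarrow>
      (let \<beta>D = stone_cech (discrete_topology D);
           K = prob_measures \<beta>D;
           D\<^sub>\<omega> = D_omega D;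
           X = subtopology \<beta>D D\<^sub>\<omega>
       in convex_compactum K \<and>
          embedding_map \<beta>D K (dirac \<beta>D) \<and>
          boundary_of_compactum K (dirac \<beta>D ` D\<^sub>\<omega>) \<and>
          weight K =o ctwo ^c continuum \<and>
          continuum <o ctwo ^c continuum \<and>
          weight X =o continuum \<and>
          cz_network_weight X =o ctwo ^c continuum \<and>
          network_weight X =o continuum))
    \<and> (\<exists>(K :: real beta set_function topology) B.
          convex_compactum K \<and> boundary_of_compactum K B \<and>
          weight (subtopology K B) <o weight K)"
  proof (intro conjI allI impI)
  have less: "continuum <o ctwo ^c continuum"
    using Cinfinite_continuum by (intro ordLess_ctwo_cexp) simp
  fix D :: "'a set" assume D: "|D| =o continuum"
  then have "D \<noteq> {}" using infinite_continuum by fastforce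
  interpret discrete_beta "stone_cech (discrete_topology D)" D "beta_embed (discrete_topology D)"
    by (rule discrete_beta_stone_cech)
  note boundary_countable_part[OF \<open>D \<noteq> {}\<close>] weights[OF D]
  note * = this[unfolded countable_part_stone_cech]
  show "let \<beta>D = stone_cech (discrete_topology D);
           K = prob_measures \<beta>D;
           D\<^sub>\<omega> = D_omega D;
           X = subtopology \<beta>D D\<^sub>\<omega>
       in convex_compactum K \<and>
          embedding_map \<beta>D K (dirac \<beta>D) \<and>
          boundary_of_compactum K (dirac \<beta>D ` D\<^sub>\<omega>) \<and>
          weight K =o ctwo ^c continuum \<and>
          continuum <o ctwo ^c continuum \<and>
          weight X =o continuum \<and>
          cz_network_weight X =o ctwo ^c continuum \<and>
          network_weight X =o continuum"
    unfolding Let_def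
    by (intro conjI convex_compactum_prob_measures[OF \<open>D \<noteq> {}\<close>] embedding_map_dirac less *)
next
  interpret discrete_beta "stone_cech (discrete_topology (UNIV :: real set))" UNIV
      "beta_embed (discrete_topology (UNIV :: real set))"
    by (rule discrete_beta_stone_cech)
  let ?X = "stone_cech (discrete_topology (UNIV :: real set))"
  have ne: "(UNIV :: real set) \<noteq> {}" by simp
  have "weight (subtopology (prob_measures ?X) (dirac ?X ` countable_part)) \<le>o continuum"
    by (rule weights(5)[OF card_of_reals])
  also have "continuum <o ctwo ^c continuum"
    using Cinfinite_continuum by (intro ordLess_ctwo_cexp) simp
  also have "ctwo ^c continuum =o weight (prob_measures ?X)"
    using weights(1)[OF card_of_reals] by (rule ordIso_symmetric)
  finally have "weight (subtopology (prob_measures ?X) (dirac ?X ` countable_part))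
      <o weight (prob_measures ?X)" .
  then show "\<exists>(K :: real beta set_function topology) B.
      convex_compactum K \<and> boundary_of_compactum K B \<and> weight (subtopology K B) <o weight K"
    using convex_compactum_prob_measures[OF ne] boundary_countable_part[OF ne] by blast
qed

end
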